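(* Let $\alpha\in(0,1]$, let $P\in\mathcal{A}$ be a self-adjoint projection with $\tau(P)=\alpha$, and let $(Y_t)_{t\ge0}$ be a free unitary Brownian motion in $(\mathcal{A},\tau)$ such that $P$ and $(Y_t)_{t\ge0}$ are $\star$-free. Let $$s_{n,1}^{(\alpha)}(t):=\tau\big((PY_tPY_t^\star)^nPY_t\big)\ (n\ge0),\qquad r_n^{(\alpha)}(t):=\tau\big((PY_tPY_t^\star)^n\big)\ (n\ge1),$$ and, in the open unit disc $|z|<1$, $$S_t^{(\alpha)}(z):=\sum_{n\ge1}s_{n,1}^{(\alpha)}(t)z^n,\qquad M_t^{(\alpha)}(z):=\sum_{n\ge1}r_n^{(\alpha)}(t)z^n.$$ Then the function $(t,z)\mapsto S_t^{(\alpha)}(z)$ satisfies the partial differential equation $$\partial_tS_t^{(\alpha)}=s_{0,1}^{(\alpha)}(t)\big[2z(\alpha+M_t^{(\alpha)})-M_t^{(\alpha)}\big]+\Big[2z(\alpha+M_t^{(\alpha)})-M_t^{(\alpha)}-\frac12\Big]S_t^{(\alpha)}+\big[2z(\alpha+M_t^{(\alpha)})-(1+2M_t^{(\alpha)})\big]z\,\partial_zS_t^{(\alpha)}.$$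
   Context: $(\mathcal{A},\tau)$ is a non-commutative $\star$-probability space: $\mathcal{A}$ is a unital von Neumann algebra with a faithful tracial state $\tau$. A free unitary Brownian motion $(Y_t)_{t\ge0}$ is the unitary-valued solution of the free stochastic differential equation $dY_t=iY_t\,dX_t-\frac12Y_t\,dt$, $Y_0=\mathbf 1$, where $(X_t)_{t\ge0}$ is a free additive Brownian motion in $\mathcal{A}$. For $n=0$, $s_{0,1}^{(\alpha)}(t)=\tau(PY_t)$. *)

theory Defs
  imports "HOL-Analysis.Analysis"
begin

section \<open>C*-algebras, Hilbert spaces and von Neumann algebras\<close>

class scaleC =
  fixes scaleC :: "complex \<Rightarrow> 'a \<Rightarrow> 'a" (infixr \<open>*\<^sub>C\<close> 75)

class complex_normed_vector = scaleC + real_normed_vector +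
  assumes scaleC_add_right: "c *\<^sub>C (x + y) = c *\<^sub>C x + c *\<^sub>C y"
    and scaleC_add_left: "(c + d) *\<^sub>C x = c *\<^sub>C x + d *\<^sub>C x"
    and scaleC_scaleC: "c *\<^sub>C (d *\<^sub>C x) = (c * d) *\<^sub>C x"
    and scaleC_of_real: "complex_of_real r *\<^sub>C x = r *\<^sub>R x"
    and norm_scaleC: "norm (c *\<^sub>C x) = cmod c * norm x"

class chilbert_space = complex_normed_vector + banach +
  fixes cinner :: "'a \<Rightarrow> 'a \<Rightarrow> complex"
  assumes cinner_commute: "cinner x y = cnj (cinner y x)"
    and cinner_add_right: "cinner x (y + z) = cinner x y + cinner x z"
    and cinner_scaleC_right: "cinner x (c *\<^sub>C y) = c * cinner x y"
    and cinner_self: "cinner x x = complex_of_real ((norm x)\<^sup>2)"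

class cstar_algebra = complex_normed_vector + real_normed_algebra_1 + banach +
  fixes star :: "'a \<Rightarrow> 'a"
  assumes mult_scaleC_left: "(c *\<^sub>C x) * y = c *\<^sub>C (x * y)"
    and mult_scaleC_right: "x * (c *\<^sub>C y) = c *\<^sub>C (x * y)"
    and star_star: "star (star x) = x"
    and star_add: "star (x + y) = star x + star y"
    and star_scaleC: "star (c *\<^sub>C x) = cnj c *\<^sub>C star x"
    and star_mult: "star (x * y) = star y * star x"
    and cstar_identity: "norm (star x * x) = (norm x)\<^sup>2"

definition bounded_operator :: "('h::chilbert_space \<Rightarrow> 'h) \<Rightarrow> bool" where
  "bounded_operator T \<longleftrightarrow> bounded_linear T \<and> (\<forall>c x. T (c *\<^sub>C x) = c *\<^sub>C T x)"

definition commutant :: "('h::chilbert_space \<Rightarrow> 'h) set \<Rightarrow> ('h \<Rightarrow> 'h) set" where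
  "commutant N = {T. bounded_operator T \<and> (\<forall>A\<in>N. T \<circ> A = A \<circ> T)}"

text \<open>The algebra, given as a type \<open>'a\<close>, is a von Neumann algebra acting on the Hilbert
  space \<open>'h\<close>: \<open>\<pi>\<close> identifies it with a unital *-subalgebra of the bounded operators
  that equals its double commutant.\<close>

definition von_neumann_algebra :: "('a::cstar_algebra \<Rightarrow> 'h::chilbert_space \<Rightarrow> 'h) \<Rightarrow> bool" where
  "von_neumann_algebra \<pi> \<longleftrightarrow>
     (\<forall>a. bounded_operator (\<pi> a)) \<and>
     inj \<pi> \<and>
     \<pi> 1 = id \<and>
     (\<forall>a b x. \<pi> (a + b) x = \<pi> a x + \<pi> b x) \<and>
     (\<forall>c a x. \<pi> (c *\<^sub>C a) x = c *\<^sub>C \<pi> a x) \<and>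
     (\<forall>a b. \<pi> (a * b) = \<pi> a \<circ> \<pi> b) \<and>
     (\<forall>a x y. cinner (\<pi> (star a) x) y = cinner x (\<pi> a y)) \<and>
     commutant (commutant (range \<pi>)) = range \<pi>"

definition faithful_tracial_state :: "('a::cstar_algebra \<Rightarrow> complex) \<Rightarrow> bool" where
  "faithful_tracial_state \<tau> \<longleftrightarrow>
     (\<forall>a b. \<tau> (a + b) = \<tau> a + \<tau> b) \<and>
     (\<forall>c a. \<tau> (c *\<^sub>C a) = c * \<tau> a) \<and>
     \<tau> 1 = 1 \<and>
     (\<forall>a. \<tau> (star a * a) \<in> \<real>\<^sub>\<ge>\<^sub>0) \<and>
     (\<forall>a b. \<tau> (a * b) = \<tau> (b * a)) \<and>
     (\<forall>a. \<tau> (star a * a) = 0 \<longrightarrow> a = 0)"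

definition self_adjoint :: "'a::cstar_algebra \<Rightarrow> bool" where
  "self_adjoint a \<longleftrightarrow> star a = a"

definition projection :: "'a::cstar_algebra \<Rightarrow> bool" where
  "projection p \<longleftrightarrow> self_adjoint p \<and> p * p = p"

definition unitary :: "'a::cstar_algebra \<Rightarrow> bool" where
  "unitary u \<longleftrightarrow> star u * u = 1 \<and> u * star u = 1"

section \<open>Freeness\<close>

definition star_subalgebra :: "'a::cstar_algebra set \<Rightarrow> bool" where
  "star_subalgebra B \<longleftrightarrow>
     1 \<in> B \<and> (\<forall>a\<in>B. \<forall>b\<in>B. a + b \<in> B \<and> a * b \<in> B) \<and>
     (\<forall>c. \<forall>a\<in>B. c *\<^sub>C a \<in> B) \<and> (\<forall>a\<in>B. star a \<in> B)"

definition free_family :: "('a::cstar_algebra \<Rightarrow> complex) \<Rightarrow> ('i \<Rightarrow> 'a set) \<Rightarrow> bool" where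
  "free_family \<tau> B \<longleftrightarrow>
     (\<forall>is as. as \<noteq> [] \<and> length as = length is \<and> distinct_adj is \<and>
        (\<forall>j<length as. as ! j \<in> B (is ! j) \<and> \<tau> (as ! j) = 0) \<longrightarrow> \<tau> (prod_list as) = 0)"

text \<open>\<open>hull\<close> is the library's closure operator: \<open>star_subalgebra hull S\<close> is the unital
  *-subalgebra generated by \<open>S\<close>.\<close>

definition star_free :: "('a::cstar_algebra \<Rightarrow> complex) \<Rightarrow> 'a set \<Rightarrow> 'a set \<Rightarrow> bool" where
  "star_free \<tau> S T \<longleftrightarrow>
     free_family \<tau> (\<lambda>b::bool. if b then star_subalgebra hull S else star_subalgebra hull T)"

section \<open>Free Brownian motions\<close>

text \<open>Wigner's semicircle law of variance \<open>v > 0\<close>, as the distribution (moment sequence) of \<open>a\<close>.\<close>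

definition semicircular :: "('a::cstar_algebra \<Rightarrow> complex) \<Rightarrow> real \<Rightarrow> 'a \<Rightarrow> bool" where
  "semicircular \<tau> v a \<longleftrightarrow> self_adjoint a \<and>
     (\<forall>n. \<tau> (a ^ n) = complex_of_real
        (integral {- 2 * sqrt v .. 2 * sqrt v} (\<lambda>x. x ^ n * sqrt (4 * v - x\<^sup>2) / (2 * pi * v))))"

text \<open>Processes and filtrations are indexed by \<open>real\<close>; only their values at times \<open>t \<ge> 0\<close>
  matter.\<close>

definition filtration :: "(real \<Rightarrow> 'a::cstar_algebra set) \<Rightarrow> bool" where
  "filtration F \<longleftrightarrow> (\<forall>t\<ge>0. star_subalgebra (F t)) \<and> (\<forall>s t. 0 \<le> s \<and> s \<le> t \<longrightarrow> F s \<subseteq> F t)"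

definition adapted :: "(real \<Rightarrow> 'a::cstar_algebra set) \<Rightarrow> (real \<Rightarrow> 'a) \<Rightarrow> bool" where
  "adapted F U \<longleftrightarrow> (\<forall>t\<ge>0. U t \<in> F t)"

definition free_brownian_motion ::
    "('a::cstar_algebra \<Rightarrow> complex) \<Rightarrow> (real \<Rightarrow> 'a set) \<Rightarrow> (real \<Rightarrow> 'a) \<Rightarrow> bool" where
  "free_brownian_motion \<tau> F X \<longleftrightarrow>
     filtration F \<and> adapted F X \<and> X 0 = 0 \<and>
     (\<forall>s t. 0 \<le> s \<and> s < t \<longrightarrow>
        semicircular \<tau> (t - s) (X t - X s) \<and> star_free \<tau> {X t - X s} (F s))"

text \<open>The free Ito integral \<open>\<integral>\<^sub>a\<^sup>b U\<^sub>s dX\<^sub>s\<close> of a norm-continuous adapted process: the limit in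
  operator norm, as the mesh tends to 0, of the left-endpoint sums, i.e. of the integrals of the
  simple adapted processes that approximate \<open>U\<close> uniformly. The noise multiplies from the
  right.\<close>

definition has_free_ito_integral ::
    "(real \<Rightarrow> 'a::cstar_algebra) \<Rightarrow> (real \<Rightarrow> 'a) \<Rightarrow> 'a \<Rightarrow> real \<Rightarrow> real \<Rightarrow> bool" where
  "has_free_ito_integral U X I a b \<longleftrightarrow>
     (\<forall>\<epsilon>>0. \<exists>\<delta>>0. \<forall>(n::nat) p. p 0 = a \<and> p n = b \<and>
        (\<forall>i<n. p i \<le> p (Suc i) \<and> p (Suc i) - p i < \<delta>) \<longrightarrow>
        norm ((\<Sum>i<n. U (p i) * (X (p (Suc i)) - X (p i))) - I) < \<epsilon>)"

text \<open>The equation \<open>dY\<^sub>t = i Y\<^sub>t dX\<^sub>t - Y\<^sub>t dt / 2\<close>, \<open>Y\<^sub>0 = 1\<close>, in integrated form.\<close>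

definition free_unitary_brownian_motion ::
    "('a::cstar_algebra \<Rightarrow> complex) \<Rightarrow> (real \<Rightarrow> 'a) \<Rightarrow> bool" where
  "free_unitary_brownian_motion \<tau> Y \<longleftrightarrow>
     (\<exists>F X. free_brownian_motion \<tau> F X \<and> adapted F Y \<and> continuous_on {0..} Y \<and>
        (\<forall>t\<ge>0. unitary (Y t)) \<and> Y 0 = 1 \<and>
        (\<forall>t\<ge>0. \<exists>I. has_free_ito_integral Y X I 0 t \<and>
           Y t - Y 0 = \<i> *\<^sub>C I - (1/2) *\<^sub>R integral {0..t} Y))"

section \<open>Moments and their generating functions\<close>

definition s_moment ::
    "('a::cstar_algebra \<Rightarrow> complex) \<Rightarrow> 'a \<Rightarrow> (real \<Rightarrow> 'a) \<Rightarrow> nat \<Rightarrow> real \<Rightarrow> complex" where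
  "s_moment \<tau> P Y n t = \<tau> ((P * Y t * P * star (Y t)) ^ n * P * Y t)"

definition r_moment ::
    "('a::cstar_algebra \<Rightarrow> complex) \<Rightarrow> 'a \<Rightarrow> (real \<Rightarrow> 'a) \<Rightarrow> nat \<Rightarrow> real \<Rightarrow> complex" where
  "r_moment \<tau> P Y n t = \<tau> ((P * Y t * P * star (Y t)) ^ n)"

text \<open>Both series start at the first power of \<open>z\<close>.\<close>

definition S_series ::
    "('a::cstar_algebra \<Rightarrow> complex) \<Rightarrow> 'a \<Rightarrow> (real \<Rightarrow> 'a) \<Rightarrow> real \<Rightarrow> complex \<Rightarrow> complex" where
  "S_series \<tau> P Y t z = (\<Sum>n. s_moment \<tau> P Y (Suc n) t * z ^ Suc n)"

definition M_series ::
    "('a::cstar_algebra \<Rightarrow> complex) \<Rightarrow> 'a \<Rightarrow> (real \<Rightarrow> 'a) \<Rightarrow> real \<Rightarrow> complex \<Rightarrow> complex" where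
  "M_series \<tau> P Y t z = (\<Sum>n. r_moment \<tau> P Y (Suc n) t * z ^ Suc n)"

end

theory Submission
  imports Defs
begin

text \<open>
  Write \<open>A\<^sub>t = P Y\<^sub>t P Y\<^sub>t\<^sup>*\<close> and \<open>G\<^sub>t(z) = (1 - z A\<^sub>t)\<^sup>-\<^sup>1\<close>. Then \<open>s\<^sub>0 + S = \<tau>(G P Y)\<close> and \<open>1 + M = \<tau>(G)\<close>, so no
  combinatorics of moments is needed: expand \<open>\<tau>(G P Y)\<close> at time \<open>t + h\<close> to second order in
  \<open>\<Delta> = Y\<^sub>t\<^sub>+\<^sub>h - Y\<^sub>t\<close>. If \<open>a, b\<close> are norm limits of words in \<open>P\<close> and \<open>Y\<^sub>t\<close>, then up to \<open>o(h)\<close>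
  \<open>\<tau>(a \<Delta>) = - (h/2) \<tau>(a Y\<^sub>t)\<close>, \<open>\<tau>(a \<Delta> b \<Delta>) = - h \<tau>(a Y\<^sub>t) \<tau>(b Y\<^sub>t)\<close> and
  \<open>\<tau>(a \<Delta> b \<Delta>\<^sup>*) = h \<tau>(a) \<tau>(b)\<close>. For \<open>a, b\<close> in the past this is the Ito isometry. The noise is not
  assumed to be free from \<open>P\<close>, but \<open>\<Delta>\<close> lies in the algebra generated by \<open>Y\<close>, which is; centring
  the letters of a word reduces the general case to the past. Terms with three factors \<open>\<Delta>\<close> are
  \<open>o(h)\<close> because \<open>Y\<close> is norm continuous. This gives a right derivative, which is continuous in
  \<open>t\<close> and hence a derivative.
\<close>

section \<open>C*-algebra preliminaries\<close>

text \<open>The operator norm of an increment is only known to tend to 0, without a rate, while its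
  L2 norm \<open>norm2\<close> is at most sqrt h. Products of increments are therefore estimated
  with two of them in \<open>norm2\<close>, which yields the factor h, and everything else in the
  operator norm, where a third increment yields o(1). This rests on \<open>norm2_mult_left\<close>,
  obtained inside the algebra from a square root of 1 - star a * a. The resolvent is only a norm
  limit of words. Hence the limits are first proved for words and then extended to the closure by
  bounds that are uniform in h. The equation closes for an algebraic reason. By cyclicity and P G P
  = G P, the words of degree at most two in the increments leave only a few traces. Those with two
  resolvents are q = \<tau>(G A G P Y), which is the z-derivative of S, and \<tau>(G G P Y), which
  the resolvent equation turns into \<tau>(G P Y) + z q. The remaining ones are expressed through
  \<tau>(P) and M by z \<tau>(G A) = M.\<close>

lemma scaleC_one [simp]: "1 *\<^sub>C (x::'a::complex_normed_vector) = x"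
  using scaleC_of_real[of 1 x] by simp

lemma scaleC_zero_left [simp]: "0 *\<^sub>C (x::'a::complex_normed_vector) = 0"
  using scaleC_of_real[of 0 x] by simp

lemma scaleC_minus_left: "(- c) *\<^sub>C (x::'a::complex_normed_vector) = - (c *\<^sub>C x)"
  using scaleC_add_left[of c "- c" x] by (simp add: eq_neg_iff_add_eq_0 add.commute)

lemma scaleC_scaleR: "c *\<^sub>C (r *\<^sub>R (x::'a::complex_normed_vector)) = r *\<^sub>R (c *\<^sub>C x)"
  by (simp add: scaleC_of_real[symmetric] scaleC_scaleC mult.commute)

lemma bounded_linear_scaleC: "bounded_linear (\<lambda>x::'a::complex_normed_vector. c *\<^sub>C x)"
  by (rule bounded_linear_intro[where K = "cmod c"])
    (simp_all add: scaleC_add_right scaleC_scaleR norm_scaleC)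

lemma scaleC_diff_right: "c *\<^sub>C (x - y::'a::complex_normed_vector) = c *\<^sub>C x - c *\<^sub>C y"
  by (rule linear_diff[OF bounded_linear.linear[OF bounded_linear_scaleC]])

lemma scaleC_power: "(c *\<^sub>C (x::'a::cstar_algebra)) ^ n = (c ^ n) *\<^sub>C (x ^ n)"
  by (induction n) (simp_all add: mult_scaleC_left mult_scaleC_right scaleC_scaleC mult.commute)

lemma star_one [simp]: "star (1::'a::cstar_algebra) = 1"
  using star_mult[of "star (1::'a)" 1] by (simp add: star_star)

lemma star_scaleR: "star (r *\<^sub>R (x::'a::cstar_algebra)) = r *\<^sub>R star x"
  using star_scaleC[of "complex_of_real r" x] by (simp add: scaleC_of_real)

lemma norm_star [simp]: "norm (star (a::'a::cstar_algebra)) = norm a"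
proof -
  have le: "norm b \<le> norm (star b)" for b :: 'a
  proof (cases "norm b = 0")
    case False
    have "(norm b)\<^sup>2 \<le> norm (star b) * norm b"
      using cstar_identity[of b] norm_mult_ineq[of "star b" b] by simp
    with False show ?thesis
      by (simp add: power2_eq_square)
  qed simp
  show ?thesis
    using le[of a] le[of "star a"] by (simp add: star_star)
qed

lemma bounded_linear_star: "bounded_linear (star :: 'a::cstar_algebra \<Rightarrow> 'a)"
  by (rule bounded_linear_intro[where K = 1]) (simp_all add: star_add star_scaleR)

lemmas star_diff = linear_diff[OF bounded_linear.linear[OF bounded_linear_star]]
lemmas star_minus = linear_neg[OF bounded_linear.linear[OF bounded_linear_star]]

lemma star_power: "star ((x::'a::cstar_algebra) ^ n) = star x ^ n"
  by (induction n) (simp_all add: star_mult power_commutes)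

lemma norm_unitary:
  assumes "unitary (u::'a::cstar_algebra)"
  shows "norm u = 1"
  using cstar_identity[of u] assms by (metis norm_ge_zero norm_one one_power2 power2_eq_iff_nonneg unitary_def zero_le_one)

lemma norm_projection_le:
  assumes "projection (p::'a::cstar_algebra)"
  shows "norm p \<le> 1"
  using cstar_identity[of p] assms
  by (auto simp: projection_def self_adjoint_def power2_eq_square)

text \<open>The binomial series of $\sqrt{1 - x}$.\<close>

lemma cstar_sqrt:
  assumes sa: "star (x::'a::cstar_algebra) = x" and x: "norm x < 1"
  obtains c where "star c = c" "c * c = 1 - x"
proof -
  define f where "f n = ((1/2::real) gchoose n) *\<^sub>R (- x) ^ n" for n
  \<comment> \<open>Each coefficient is the previous one times (1/2 - n)/(n + 1), which has modulus
    at most 1; so the series is dominated by the geometric series of norm x.\<close>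
  have coeff: "\<bar>(1/2::real) gchoose n\<bar> \<le> 1" for n
  proof (induction n)
    case (Suc n)
    have "real (Suc n) * ((1/2) gchoose Suc n) = (1/2 - real n) * ((1/2::real) gchoose n)"
      using gbinomial_mult_1[of "1/2::real" n] by (simp add: algebra_simps)
    then have "real (Suc n) * \<bar>(1/2) gchoose Suc n\<bar> = \<bar>1/2 - real n\<bar> * \<bar>(1/2::real) gchoose n\<bar>"
      by (metis abs_mult abs_of_nat)
    also have "\<dots> \<le> real (Suc n) * 1"
      by (intro mult_mono Suc) auto
    finally show ?case
      by (subst (asm) mult_le_cancel_left_pos) simp_all
  qed simp
  have sf: "summable (\<lambda>n. norm (f n))"
  proof (rule summable_comparison_test')
    show "summable (\<lambda>n. norm x ^ n)"
      using x by (intro summable_geometric) simp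
    show "norm (norm (f n)) \<le> norm x ^ n" if "n \<ge> 0" for n
    proof -
      have "norm (f n) \<le> 1 * norm ((- x) ^ n)"
        unfolding f_def norm_scaleR by (intro mult_right_mono) (use coeff[of n] in auto)
      also have "\<dots> \<le> norm x ^ n"
        using norm_power_ineq[of "- x" n] by simp
      finally show ?thesis by simp
    qed
  qed
  have s: "summable f"
    by (rule summable_norm_cancel[OF sf])
  define c where "c = suminf f"
  have "star c = (\<Sum>n. star (f n))"
    unfolding c_def by (rule bounded_linear.suminf[OF bounded_linear_star s])
  also have "(\<lambda>n. star (f n)) = f"
    unfolding f_def by (simp add: star_scaleR star_power star_minus sa)
  finally have 1: "star c = c"
    by (simp add: c_def)
  \<comment> \<open>Vandermonde with 1/2 + 1/2 = 1: the Cauchy square has the coefficients 1 choose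
    k, which vanish from k = 2 on.\<close>
  have conv: "(\<Sum>i\<le>k. f i * f (k - i)) = ((1::real) gchoose k) *\<^sub>R (- x) ^ k" for k
  proof -
    have "(\<Sum>i\<le>k. f i * f (k - i)) = (\<Sum>i\<le>k. (((1/2::real) gchoose i) * ((1/2) gchoose (k - i))) *\<^sub>R (- x) ^ k)"
      by (rule sum.cong) (simp_all add: f_def power_add[symmetric] mult.commute)
    also have "\<dots> = ((1::real) gchoose k) *\<^sub>R (- x) ^ k"
      using gbinomial_Vandermonde[of "1/2::real" "1/2" k]
      by (simp add: scaleR_sum_left[symmetric] atMost_atLeast0)
    finally show ?thesis .
  qed
  have "c * c = (\<Sum>k. \<Sum>i\<le>k. f i * f (k - i))"
    unfolding c_def by (rule Cauchy_product[OF sf sf])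
  also have "\<dots> = (\<Sum>k. ((1::real) gchoose k) *\<^sub>R (- x) ^ k)"
    by (simp only: conv)
  also have "\<dots> = (\<Sum>k\<in>{0,1}. ((1::real) gchoose k) *\<^sub>R (- x) ^ k)"
  proof (rule suminf_finite)
    fix k :: nat assume "k \<notin> {0, 1}"
    then show "((1::real) gchoose k) *\<^sub>R (- x) ^ k = 0"
      using binomial_gbinomial[of 1 k, where 'a = real] by (simp add: binomial_eq_0)
  qed simp
  also have "\<dots> = 1 - x"
    by simp
  finally show ?thesis
    using that 1 by blast
qed

section \<open>Tracial states\<close>

locale tracial_state =
  fixes \<tau> :: "'a::cstar_algebra \<Rightarrow> complex"
  assumes tracial: "faithful_tracial_state \<tau>"
begin

lemma tau_add: "\<tau> (a + b) = \<tau> a + \<tau> b"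
  and tau_scaleC: "\<tau> (c *\<^sub>C a) = c * \<tau> a"
  and tau_one [simp]: "\<tau> 1 = 1"
  and tau_pos: "\<tau> (star a * a) \<in> \<real>\<^sub>\<ge>\<^sub>0"
  and tau_commute: "\<tau> (a * b) = \<tau> (b * a)"
  using tracial by (auto simp: faithful_tracial_state_def)

lemma tau_scaleR: "\<tau> (r *\<^sub>R a) = r * \<tau> a"
  using tau_scaleC[of "complex_of_real r" a] by (simp add: scaleC_of_real)

lemma tau_linear: "linear \<tau>"
  by (rule linearI) (simp_all add: tau_add tau_scaleR scaleR_conv_of_real[where 'a = complex])

lemmas tau_zero [simp] = linear_0[OF tau_linear]
lemmas tau_diff = linear_diff[OF tau_linear]

lemma tau_pos': "Im (\<tau> (star a * a)) = 0" "0 \<le> Re (\<tau> (star a * a))"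
  using tau_pos[of a] by (auto simp: complex_nonneg_Reals_iff)

text \<open>Polarisation: positivity at 1 + b makes \<tau> (star b) + \<tau> b real. Taking b = a
  compares the imaginary parts, b = i a the real parts.\<close>

lemma tau_star: "\<tau> (star a) = cnj (\<tau> a)"
proof -
  have Im: "Im (\<tau> (star b) + \<tau> b) = 0" for b
  proof -
    have "star (1 + b) * (1 + b) = 1 + b + star b + star b * b"
      by (simp add: algebra_simps star_add)
    then show ?thesis
      using tau_pos'(1)[of "1 + b"] tau_pos'(1)[of b] by (simp add: tau_add)
  qed
  show ?thesis
    using Im[of a] Im[of "\<i> *\<^sub>C a"] by (simp add: star_scaleC tau_scaleC complex_eq_iff)
qed

section \<open>The L2 norm of the trace (the norm of the GNS space) against the operator
  norm\<close>

definition norm2 :: "'a \<Rightarrow> real" where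
  "norm2 a = sqrt (Re (\<tau> (star a * a)))"

lemma norm2_nonneg [simp]: "0 \<le> norm2 a"
  by (simp add: norm2_def tau_pos')

lemma norm2_square: "complex_of_real ((norm2 a)\<^sup>2) = \<tau> (star a * a)"
  by (simp add: norm2_def tau_pos' complex_eq_iff)

lemma norm2_square': "(norm2 a)\<^sup>2 = Re (\<tau> (star a * a))"
  by (simp add: norm2_def tau_pos')

lemma norm2_star [simp]: "norm2 (star a) = norm2 a"
  by (simp add: norm2_def star_star tau_commute)

lemma norm2_scaleC: "norm2 (c *\<^sub>C a) = cmod c * norm2 a"
proof -
  have "\<tau> (star (c *\<^sub>C a) * (c *\<^sub>C a)) = complex_of_real ((cmod c)\<^sup>2) * \<tau> (star a * a)"
    by (simp add: star_scaleC mult_scaleC_left mult_scaleC_right tau_scaleC complex_norm_square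
        mult_ac del: of_real_power)
  then show ?thesis
    by (simp add: norm2_def real_sqrt_mult)
qed

lemma cauchy_schwarz: "cmod (\<tau> (star a * b)) \<le> norm2 a * norm2 b"
proof -
  define k where "k = \<tau> (star a * b)"
  have ba: "\<tau> (star b * a) = cnj k"
    unfolding k_def tau_star[symmetric] by (simp add: star_mult star_star)
  have main: "0 \<le> r\<^sup>2 * (cmod k)\<^sup>2 * (norm2 a)\<^sup>2 - 2 * r * (cmod k)\<^sup>2 + (norm2 b)\<^sup>2" for r
  proof -
    \<comment> \<open>The phase of \<open>k\<close> is put into \<open>c\<close>, so that both cross
      terms become real and the expansion is a real quadratic in \<open>r\<close>.\<close>
    define c where "c = complex_of_real r * k"
    have kk: "cnj k * k = complex_of_real ((cmod k)\<^sup>2)"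
      by (metis complex_norm_square mult.commute)
    have "cnj c * c = complex_of_real (r\<^sup>2) * (cnj k * k)" "cnj c * k = complex_of_real r * (cnj k * k)"
      "c * cnj k = complex_of_real r * (cnj k * k)"
      by (simp_all add: c_def power2_eq_square mult_ac)
    then have c: "cnj c * c = complex_of_real (r\<^sup>2 * (cmod k)\<^sup>2)" "cnj c * k = complex_of_real (r * (cmod k)\<^sup>2)"
      "c * cnj k = complex_of_real (r * (cmod k)\<^sup>2)"
      by (simp_all only: kk of_real_mult)
    have "star (c *\<^sub>C a - b) * (c *\<^sub>C a - b) = (cnj c * c) *\<^sub>C (star a * a)
        - cnj c *\<^sub>C (star a * b) - c *\<^sub>C (star b * a) + star b * b"
      by (simp add: star_diff star_scaleC left_diff_distrib right_diff_distrib mult_scaleC_left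
          mult_scaleC_right scaleC_scaleC scaleC_diff_right mult.commute[of "cnj c" c] algebra_simps)
    then have "\<tau> (star (c *\<^sub>C a - b) * (c *\<^sub>C a - b)) =
        (cnj c * c) * \<tau> (star a * a) - cnj c * k - c * cnj k + \<tau> (star b * b)"
      by (simp add: tau_add tau_diff tau_scaleC ba k_def[symmetric])
    also have "\<dots> = complex_of_real (r\<^sup>2 * (cmod k)\<^sup>2 * (norm2 a)\<^sup>2 - 2 * r * (cmod k)\<^sup>2 + (norm2 b)\<^sup>2)"
      by (simp only: c norm2_square[symmetric]) simp
    finally show ?thesis
      using tau_pos'(2)[of "c *\<^sub>C a - b"] by simp
  qed
  have "(cmod k)\<^sup>2 \<le> (norm2 a * norm2 b)\<^sup>2"
  proof (cases "norm2 a = 0 \<or> k = 0")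
    case False
    \<comment> \<open>The quadratic is evaluated at its minimiser.\<close>
    then have "(cmod k)\<^sup>2 / (norm2 a)\<^sup>2 \<le> (norm2 b)\<^sup>2"
      using main[of "1 / (norm2 a)\<^sup>2"] by (simp add: power2_eq_square)
    then show ?thesis
      using False by (simp add: pos_divide_le_eq power_mult_distrib mult.commute)
  next
    case True
    have "k = 0" if "norm2 a = 0"
    proof (rule ccontr)
      assume "k \<noteq> 0"
      \<comment> \<open>For norm2 a = 0 the quadratic degenerates to an affine function of negative
        slope; at this \<open>r\<close> its value is -1.\<close>
      then show False
        using main[of "((norm2 b)\<^sup>2 + 1) / (2 * (cmod k)\<^sup>2)"] that by simp
    qed
    with True show ?thesis by auto
  qed
  then show ?thesis
    unfolding k_def by (rule power2_le_imp_le) simp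
qed


text \<open>The square of the right side exceeds that of the left by exactly the square of norm2 (c
  * x).\<close>

lemma norm2_le_contraction_left:
  assumes "star c = c" "c * c = 1 - star a * a"
  shows "norm2 (a * x) \<le> norm2 x"
proof -
  have "star (c * x) * (c * x) = star x * (c * c) * x"
    by (simp add: star_mult assms(1) mult.assoc)
  also have "\<dots> = star x * x - star (a * x) * (a * x)"
    by (simp add: assms(2) star_mult algebra_simps)
  finally have "star (c * x) * (c * x) = star x * x - star (a * x) * (a * x)" .
  then show ?thesis
    using tau_pos'(2)[of "c * x"] by (simp add: norm2_def tau_diff)
qed

lemma norm2_mult_left: "norm2 (a * x) \<le> norm a * norm2 x"
proof -
  \<comment> \<open>The square root requires norm strictly below 1, so \<open>a\<close> is divided
    by some r > norm a, and \<open>r\<close> decreases to norm a at the end.\<close>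
  have *: "norm2 (a * x) \<le> r * norm2 x" if r: "r > norm a" for r
  proof -
    have r0: "r > 0"
      using r norm_ge_zero[of a] by linarith
    define b where "b = (1 / r) *\<^sub>R a"
    have "norm b < 1"
      using r r0 by (simp add: b_def)
    then have "norm (star b * b) < 1"
      by (simp add: cstar_identity abs_square_less_1)
    then obtain c where "star c = c" "c * c = 1 - star b * b"
      using cstar_sqrt[of "star b * b"] by (auto simp: star_mult star_star)
    then have "norm2 (b * x) \<le> norm2 x"
      by (rule norm2_le_contraction_left)
    moreover have "norm2 (b * x) = (1 / r) * norm2 (a * x)"
      using norm2_scaleC[of "complex_of_real (1 / r)" "a * x"] r0
      unfolding scaleC_of_real b_def by (simp add: norm_divide)
    ultimately show ?thesis
      using r0 by (simp add: field_simps)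
  qed
  show ?thesis
  proof (rule tendsto_lowerbound)
    show "((\<lambda>r. r * norm2 x) \<longlongrightarrow> norm a * norm2 x) (at_right (norm a))"
      by (intro tendsto_intros)
    show "\<forall>\<^sub>F r in at_right (norm a). norm2 (a * x) \<le> r * norm2 x"
      using * by (auto simp: eventually_at_filter)
  qed simp
qed

lemma norm2_mult_right: "norm2 (x * a) \<le> norm a * norm2 x"
  using norm2_mult_left[of "star a" "star x"] norm2_star[of "x * a"] by (simp add: star_mult)

lemma norm2_one [simp]: "norm2 1 = 1"
  by (simp add: norm2_def)

lemma norm2_le_norm: "norm2 a \<le> norm a"
  using norm2_mult_left[of a 1] by simp

lemma tau_bound: "cmod (\<tau> a) \<le> norm a"
  using cauchy_schwarz[of 1 a] norm2_le_norm[of a] by simp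

lemma bounded_linear_tau: "bounded_linear \<tau>"
  by (rule bounded_linear_intro[where K = 1])
    (simp_all add: tau_add linear_scale[OF tau_linear] tau_bound)

lemma norm2_add_le: "norm2 (a + b) \<le> norm2 a + norm2 b"
proof -
  have "(norm2 (a + b))\<^sup>2 = (norm2 a)\<^sup>2 + (norm2 b)\<^sup>2 + (Re (\<tau> (star a * b)) + Re (\<tau> (star b * a)))"
    by (simp add: norm2_square' star_add algebra_simps tau_add)
  also have "Re (\<tau> (star a * b)) \<le> norm2 a * norm2 b"
    using complex_Re_le_cmod cauchy_schwarz order_trans by blast
  also have "Re (\<tau> (star b * a)) \<le> norm2 a * norm2 b"
    using complex_Re_le_cmod[of "\<tau> (star b * a)"] cauchy_schwarz[of b a] by (simp add: mult.commute)
  finally have "(norm2 (a + b))\<^sup>2 \<le> (norm2 a + norm2 b)\<^sup>2"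
    by (simp add: power2_eq_square algebra_simps)
  then show ?thesis
    by (rule power2_le_imp_le) simp
qed

lemma norm2_minus [simp]: "norm2 (- a) = norm2 a"
  by (simp add: norm2_def star_minus)

text \<open>The basic estimate for two increments \<open>x\<close>, \<open>y\<close>: each is of
  order sqrt h in \<open>norm2\<close>, so the trace is of order h whatever the bounded coefficients
  are.\<close>

lemma tau_two_noise_bound: "cmod (\<tau> (a * x * b * y)) \<le> norm a * norm b * (norm2 x * norm2 y)"
proof -
  have "cmod (\<tau> (a * x * b * y)) \<le> norm2 (a * x) * norm2 (b * y)"
    using cauchy_schwarz[of "star (a * x)" "b * y"] by (simp add: star_star mult.assoc)
  also have "\<dots> \<le> (norm a * norm2 x) * (norm b * norm2 y)"
    by (intro mult_mono norm2_mult_left) auto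
  finally show ?thesis by (simp add: mult_ac)
qed

end

section \<open>Free products of subalgebras\<close>

lemma star_subalgebra_hull: "star_subalgebra (star_subalgebra hull S)"
  unfolding hull_def by (auto simp: star_subalgebra_def)

lemma star_subalgebra_Int:
  "star_subalgebra B \<Longrightarrow> star_subalgebra C \<Longrightarrow> star_subalgebra (B \<inter> C)"
  by (auto simp: star_subalgebra_def)

lemma hull_star_subalgebra: "star_subalgebra B \<Longrightarrow> star_subalgebra hull B = B"
  by (rule hull_same)

context
  fixes B :: "'a::cstar_algebra set"
  assumes B: "star_subalgebra B"
begin

lemma subalgebra_one: "1 \<in> B"
  and subalgebra_add: "a \<in> B \<Longrightarrow> b \<in> B \<Longrightarrow> a + b \<in> B"
  and subalgebra_mult: "a \<in> B \<Longrightarrow> b \<in> B \<Longrightarrow> a * b \<in> B"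
  and subalgebra_scaleC: "a \<in> B \<Longrightarrow> c *\<^sub>C a \<in> B"
  and subalgebra_star: "a \<in> B \<Longrightarrow> star a \<in> B"
  using B by (auto simp: star_subalgebra_def)

lemma subalgebra_scaleR: "a \<in> B \<Longrightarrow> r *\<^sub>R a \<in> B"
  using subalgebra_scaleC[of a "complex_of_real r"] by (simp add: scaleC_of_real)

lemma subalgebra_minus: "a \<in> B \<Longrightarrow> - a \<in> B"
  using subalgebra_scaleR[of a "-1"] by simp

lemma subalgebra_diff: "a \<in> B \<Longrightarrow> b \<in> B \<Longrightarrow> a - b \<in> B"
  using subalgebra_add[OF _ subalgebra_minus, of a b] by simp

lemma subalgebra_zero: "0 \<in> B"
  using subalgebra_scaleC[OF subalgebra_one, of 0] by simp

end

lemmas subalgebra_intros = subalgebra_one subalgebra_add subalgebra_mult subalgebra_scaleC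
  subalgebra_star subalgebra_scaleR subalgebra_minus subalgebra_diff subalgebra_zero

context tracial_state
begin

section \<open>Centred elements and reduced words\<close>

definition centre :: "'a \<Rightarrow> 'a" where
  "centre a = a - \<tau> a *\<^sub>C 1"

lemma tau_centre [simp]: "\<tau> (centre a) = 0"
  by (simp add: centre_def tau_diff tau_scaleC)

lemma centre_in: "star_subalgebra B \<Longrightarrow> a \<in> B \<Longrightarrow> centre a \<in> B"
  unfolding centre_def by (intro subalgebra_intros)

lemma tau_split_centre: "\<tau> (a * x * b) = \<tau> (a * centre x * b) + \<tau> x * \<tau> (a * b)"
  by (simp add: centre_def algebra_simps tau_diff mult_scaleC_left mult_scaleC_right tau_scaleC)

lemma tau_split_centre_right: "\<tau> (a * x) = \<tau> (a * centre x) + \<tau> x * \<tau> a"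
  using tau_split_centre[of a x 1] by simp

lemma tau_split_centre_left: "\<tau> (x * b) = \<tau> (centre x * b) + \<tau> x * \<tau> b"
  using tau_split_centre[of 1 x b] by simp

text \<open>A reduced word in the sense of free products. The first and last index are recorded
  because they decide whether two words may be concatenated.\<close>

definition alternating :: "('i \<Rightarrow> 'a set) \<Rightarrow> 'i \<Rightarrow> 'i \<Rightarrow> 'a \<Rightarrow> bool" where
  "alternating A i j a \<longleftrightarrow> (\<exists>is as. as \<noteq> [] \<and> length as = length is \<and> distinct_adj is \<and>
     (\<forall>k<length as. as ! k \<in> A (is ! k) \<and> \<tau> (as ! k) = 0) \<and>
     hd is = i \<and> last is = j \<and> prod_list as = a)"

lemma alternating_single: "a \<in> A i \<Longrightarrow> \<tau> a = 0 \<Longrightarrow> alternating A i i a"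
  unfolding alternating_def by (rule exI[of _ "[i]"], rule exI[of _ "[a]"]) simp

lemma alternating_mult:
  assumes "alternating A i j a" "alternating A k l b" "j \<noteq> k"
  shows "alternating A i l (a * b)"
proof -
  obtain js as where 1: "as \<noteq> []" "length as = length js" "distinct_adj js"
    "\<forall>k<length as. as ! k \<in> A (js ! k) \<and> \<tau> (as ! k) = 0" "hd js = i" "last js = j" "prod_list as = a"
    using assms(1) unfolding alternating_def by blast
  obtain ks bs where 2: "bs \<noteq> []" "length bs = length ks" "distinct_adj ks"
    "\<forall>j<length bs. bs ! j \<in> A (ks ! j) \<and> \<tau> (bs ! j) = 0" "hd ks = k" "last ks = l" "prod_list bs = b"
    using assms(2) unfolding alternating_def by blast
  have ne: "js \<noteq> []" "ks \<noteq> []"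
    using 1 2 by auto
  show ?thesis
    unfolding alternating_def
    using 1 2 ne assms(3)
    by (intro exI[of _ "js @ ks"] exI[of _ "as @ bs"])
      (auto simp: distinct_adj_append_iff nth_append)
qed

lemma tau_alternating: "free_family \<tau> A \<Longrightarrow> alternating A i j a \<Longrightarrow> \<tau> a = 0"
proof -
  assume free: "free_family \<tau> A" and "alternating A i j a"
  then obtain js as where "as \<noteq> []" "length as = length js" "distinct_adj js"
    "\<forall>k<length as. as ! k \<in> A (js ! k) \<and> \<tau> (as ! k) = 0" "prod_list as = a"
    unfolding alternating_def by blast
  with free show "\<tau> a = 0"
    unfolding free_family_def by blast
qed

text \<open>Every letter from \<open>B\<close> is split into its centred part and a scalar. Fully
  centred alternating words have trace zero, so only the scalar parts survive.\<close>

lemma free_pair_moments: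
  assumes free: "star_free \<tau> {x} B" and B: "star_subalgebra B" and x: "\<tau> x = 0"
    and ab: "a \<in> B" "b \<in> B"
  shows "\<tau> (a * x) = 0" "\<tau> (a * x * b * x) = \<tau> a * \<tau> b * \<tau> (x * x)" "\<tau> (a * x * x) = \<tau> a * \<tau> (x * x)"
proof -
  define A where "A = (\<lambda>b::bool. if b then star_subalgebra hull {x} else star_subalgebra hull B)"
  have fr: "free_family \<tau> A"
    using free unfolding star_free_def A_def .
  have AT: "star_subalgebra (A True)" and AF: "A False = B"
    by (simp_all add: A_def star_subalgebra_hull hull_star_subalgebra B)
  have xA: "x \<in> A True"
    by (simp add: A_def hull_inc)
  have alx: "alternating A True True x"
    by (rule alternating_single) (use xA x in auto)
  have alc: "alternating A False False (centre c)" if "c \<in> B" for c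
    by (rule alternating_single) (use that AF centre_in[OF B] in auto)
  have one: "\<tau> (c * x) = 0" if "c \<in> B" for c
    using tau_split_centre_left[of c x] x tau_alternating[OF fr alternating_mult[OF alc[OF that] alx]]
    by simp
  \<comment> \<open>The square of \<open>x\<close> lies in the algebra generated by
    \<open>x\<close>, so after centring it counts as one letter, not two.\<close>
  have xx: "alternating A True True (centre (x * x))"
    by (rule alternating_single) (use AT xA in \<open>auto intro!: centre_in subalgebra_intros\<close>)
  have two: "\<tau> (c * x * x) = \<tau> c * \<tau> (x * x)" if "c \<in> B" for c
    using tau_split_centre_left[of c "x * x"] tau_split_centre_right[of "centre c" "x * x"]
      tau_alternating[OF fr alternating_mult[OF alc[OF that] xx]]
    by (simp add: mult.assoc)
  have "\<tau> (a * x * b * x) = \<tau> (centre a * x * b * x) + \<tau> a * \<tau> (x * b * x)"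
    using tau_split_centre_left[of a "x * b * x"] by (simp add: mult.assoc)
  also have "\<tau> (x * b * x) = \<tau> (b * x * x)"
    using tau_commute[of x "b * x"] by (simp add: mult.assoc)
  also have "\<tau> (centre a * x * b * x) = \<tau> (centre a * x * centre b * x) + \<tau> b * \<tau> (centre a * x * x)"
    using tau_split_centre[of "centre a * x" b x] by (simp add: mult.assoc)
  also have "\<tau> (centre a * x * centre b * x) = 0"
    by (rule tau_alternating[OF fr alternating_mult[OF alternating_mult[OF alternating_mult[OF alc alx] alc] alx]])
      (use ab in auto)
  finally show "\<tau> (a * x * b * x) = \<tau> a * \<tau> b * \<tau> (x * x)"
    using two[OF centre_in[OF B ab(1)]] two[OF ab(2)] by simp
  show "\<tau> (a * x) = 0" "\<tau> (a * x * x) = \<tau> a * \<tau> (x * x)"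
    using one two ab by auto
qed

end

text \<open>\<open>B\<close> (later the past) supplies the coefficients of words. The larger
  \<open>C\<close> (later the algebra of the whole process) must also contain the increments, and
  \<open>P\<close> is free from all of it.\<close>

locale free_projection = tracial_state \<tau> for \<tau> :: "'a::cstar_algebra \<Rightarrow> complex" +
  fixes P :: 'a and B C :: "'a set"
  assumes P: "projection P"
    and B: "star_subalgebra B" and C: "star_subalgebra C" and BC: "B \<subseteq> C"
    and free_PC: "star_free \<tau> {P} C"
begin

abbreviation p :: 'a where "p \<equiv> centre P"

definition factor :: "bool \<Rightarrow> 'a set" where
  "factor b = (if b then star_subalgebra hull {P} else C)"

lemma free_factor: "free_family \<tau> factor"
  using free_PC unfolding star_free_def factor_def hull_star_subalgebra[OF C] .

lemma P_square: "P * P = P"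
  using P by (simp add: projection_def)

lemma p_square: "p * p = (1 - 2 * \<tau> P) *\<^sub>C p + (\<tau> P - \<tau> P * \<tau> P) *\<^sub>C 1"
proof -
  have "(1 - 2 * \<tau> P) *\<^sub>C p + (\<tau> P - \<tau> P * \<tau> P) *\<^sub>C 1 = P - \<tau> P *\<^sub>C P - \<tau> P *\<^sub>C P + (\<tau> P * \<tau> P) *\<^sub>C 1"
  proof -
    have "(1 - 2 * \<tau> P) *\<^sub>C x = x - \<tau> P *\<^sub>C x - \<tau> P *\<^sub>C x" for x :: 'a
      using scaleC_add_left[of "1 + - \<tau> P" "- \<tau> P" x] scaleC_add_left[of 1 "- \<tau> P" x]
      by (simp add: scaleC_minus_left)
    moreover have "(\<tau> P - \<tau> P * \<tau> P) *\<^sub>C x = \<tau> P *\<^sub>C x - (\<tau> P * \<tau> P) *\<^sub>C x" for x :: 'a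
      using scaleC_add_left[of "\<tau> P" "- (\<tau> P * \<tau> P)" x] by (simp add: scaleC_minus_left)
    ultimately show ?thesis
      by (simp add: centre_def scaleC_diff_right) (simp add: scaleC_scaleC)
  qed
  also have "\<dots> = p * p"
    by (simp add: centre_def algebra_simps mult_scaleC_left mult_scaleC_right P_square scaleC_scaleC
        scaleC_diff_right)
  finally show ?thesis ..
qed

text \<open>With \<open>p = P - \<tau>(P)\<close>, the words \<open>b v c\<close> below have trace zero against all of \<open>C\<close>. The relation
  \<open>p\<^sup>2 \<in> span {p, 1}\<close> makes their span \<open>T\<close> stable under right multiplication by \<open>P\<close> and \<open>B\<close>, so \<open>T\<close>
  contains the algebra generated by \<open>P\<close> and \<open>B\<close>.\<close>

inductive_set V :: "'a set" where
  V_base: "p \<in> V"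
| V_step: "v \<in> V \<Longrightarrow> b \<in> B \<Longrightarrow> \<tau> b = 0 \<Longrightarrow> v * b * p \<in> V"

inductive_set T :: "'a set" where
  T_base: "b \<in> B \<Longrightarrow> b \<in> T"
| T_word: "b \<in> B \<Longrightarrow> v \<in> V \<Longrightarrow> c \<in> B \<Longrightarrow> b * v * c \<in> T"
| T_add: "x \<in> T \<Longrightarrow> y \<in> T \<Longrightarrow> x + y \<in> T"

section \<open>Traces of words in \<open>p\<close> and \<open>B\<close> against elements of
  \<open>C\<close>\<close>

lemma alternating_p: "alternating factor True True p"
  using centre_in[OF star_subalgebra_hull hull_inc[of P "{P}"]]
  by (intro alternating_single) (simp_all add: factor_def)

lemma alternating_V: "v \<in> V \<Longrightarrow> alternating factor True True v"
proof (induction rule: V.induct)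
  case (V_step v b)
  have "alternating factor False False b"
    by (rule alternating_single) (use V_step BC in \<open>auto simp: factor_def\<close>)
  with V_step show ?case
    by (intro alternating_mult[OF alternating_mult[OF _ _] alternating_p]) auto
qed (rule alternating_p)

lemma alternating_centre: "c \<in> C \<Longrightarrow> alternating factor False False (centre c)"
  by (rule alternating_single) (auto simp: factor_def intro!: centre_in C)

lemma tau_V: "v \<in> V \<Longrightarrow> \<tau> v = 0"
  by (rule tau_alternating[OF free_factor alternating_V])

lemma tau_V_mult: "v \<in> V \<Longrightarrow> c \<in> C \<Longrightarrow> \<tau> (v * c) = 0"
  using tau_split_centre_right[of v c] tau_V[of v]
    tau_alternating[OF free_factor alternating_mult[OF alternating_V[of v] alternating_centre[of c]]] by simp

text \<open>Cyclicity collects the three factors around \<open>v\<close> into a single element of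
  \<open>C\<close>.\<close>

lemma tau_word:
  assumes "b \<in> B" "v \<in> V" "b' \<in> B" "c \<in> C"
  shows "\<tau> (b * v * b' * c) = 0"
proof -
  have "\<tau> (b * v * b' * c) = \<tau> (v * (b' * c * b))"
    using tau_commute[of b "v * b' * c"] by (simp add: mult.assoc)
  then show ?thesis
    using assms BC C by (simp add: tau_V_mult subalgebra_mult subsetD)
qed

text \<open>Expansion of the vanishing trace with \<open>c\<close> and \<open>d\<close> centred.
  Each surviving term carries \<tau> c or \<tau> d, which is O(h) once \<open>c\<close> and
  \<open>d\<close> contain an increment.\<close>

lemma tau_two_words:
  assumes "v \<in> V" "w \<in> V" "c \<in> C" "d \<in> C"
  shows "\<tau> (v * c * w * d) = \<tau> c * \<tau> (v * w * d) + \<tau> d * \<tau> (v * c * w) - \<tau> c * \<tau> d * \<tau> (v * w)"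
proof -
  have "\<tau> (v * centre c * w * centre d) = 0"
    by (rule tau_alternating[OF free_factor alternating_mult[OF alternating_mult[OF
          alternating_mult[OF alternating_V alternating_centre] alternating_V] alternating_centre]])
      (use assms in auto)
  moreover have "\<tau> (v * c * w * d) = \<tau> (v * centre c * w * d) + \<tau> c * \<tau> (v * w * d)"
    using tau_split_centre[of v c "w * d"] by (simp add: mult.assoc)
  moreover have "\<tau> (v * centre c * w * d) = \<tau> (v * centre c * w * centre d) + \<tau> d * \<tau> (v * centre c * w)"
    using tau_split_centre_right[of "v * centre c * w" d] by simp
  moreover have "\<tau> (v * c * w) = \<tau> (v * centre c * w) + \<tau> c * \<tau> (v * w)"
    using tau_split_centre[of v c w] by simp
  ultimately show ?thesis
    by (simp add: algebra_simps)
qed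

section \<open>Stability of the span \<open>T\<close> and of its closure\<close>

lemma T_scaleC: "x \<in> T \<Longrightarrow> c *\<^sub>C x \<in> T"
proof (induction rule: T.induct)
  case (T_word b v b')
  then show ?case
    using T.T_word[of "c *\<^sub>C b" v b'] B by (simp add: mult_scaleC_left subalgebra_scaleC)
qed (auto simp: scaleC_add_right intro: T.intros subalgebra_scaleC[OF B])

lemma T_mult_B: "x \<in> T \<Longrightarrow> b \<in> B \<Longrightarrow> x * b \<in> T"
proof (induction rule: T.induct)
  case (T_word b' v c)
  then show ?case
    using T.T_word[of b' v "c * b"] B by (simp add: mult.assoc subalgebra_mult)
qed (auto simp: distrib_right intro: T.intros subalgebra_mult[OF B])

text \<open>\<open>v\<close> ends in \<open>p\<close>, so a factor p * p arises; it reproduces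
  \<open>v\<close> up to a scalar and adds the word with the last \<open>p\<close> dropped.\<close>

lemma T_word_mult_p:
  assumes "b \<in> B" "v \<in> V"
  shows "b * v * p \<in> T"
  using assms(2)
proof cases
  case V_base
  have "b * v * p = b * p * ((1 - 2 * \<tau> P) *\<^sub>C 1) + (\<tau> P - \<tau> P * \<tau> P) *\<^sub>C b"
    by (simp add: V_base mult.assoc p_square distrib_left mult_scaleC_right)
  also have "\<dots> \<in> T"
    by (intro T.intros V.intros assms subalgebra_intros B)
  finally show ?thesis .
next
  case (V_step w d)
  have "b * v * p = b * v * ((1 - 2 * \<tau> P) *\<^sub>C 1) + b * w * ((\<tau> P - \<tau> P * \<tau> P) *\<^sub>C d)"
    by (simp add: V_step mult.assoc p_square distrib_left mult_scaleC_right mult_scaleC_left)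
  also have "\<dots> \<in> T"
    by (intro T.intros assms V_step subalgebra_intros B)
  finally show ?thesis .
qed

lemma T_mult_p: "x \<in> T \<Longrightarrow> x * p \<in> T"
proof (induction rule: T.induct)
  case (T_base b)
  then show ?case
    using T.T_word[of b p 1] V_base subalgebra_one[OF B] by simp
next
  case (T_word b v c)
  \<comment> \<open>The centred part of \<open>c\<close> prolongs \<open>v\<close> by one letter;
    the scalar part lets two letters \<open>p\<close> meet.\<close>
  have "b * v * c * p = b * (v * centre c * p) * 1 + \<tau> c *\<^sub>C (b * v * p)"
    by (simp add: centre_def[of c] algebra_simps mult_scaleC_left mult_scaleC_right)
  also have "\<dots> \<in> T"
    using T_word by (intro T.T_add T.T_word T_scaleC T_word_mult_p V.V_step centre_in subalgebra_intros B) auto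
  finally show ?case .
qed (auto simp: distrib_right intro: T.intros)

lemma T_mult_P: "x \<in> T \<Longrightarrow> x * P \<in> T"
proof -
  assume x: "x \<in> T"
  have "x * P = x * p + \<tau> P *\<^sub>C x"
    by (simp add: centre_def algebra_simps mult_scaleC_right)
  then show ?thesis
    using x by (simp add: T.T_add T_mult_p T_scaleC)
qed

text \<open>\<open>R\<close> is a closed algebra inside \<open>closure T\<close>; that \<open>closure T\<close> is itself an algebra is never needed.\<close>

definition R :: "'a set" where
  "R = {a. \<forall>x\<in>closure T. x * a \<in> closure T}"

lemma closure_T_I: "x \<in> T \<Longrightarrow> x \<in> closure T"
  using closure_subset by blast

lemma closure_T_map:
  assumes "bounded_linear f" "\<And>x. x \<in> T \<Longrightarrow> f x \<in> closure T" "x \<in> closure T"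
  shows "f x \<in> closure T"
proof -
  have "f ` closure T \<subseteq> closure T"
    by (rule image_closure_subset)
      (use assms in \<open>auto intro: linear_continuous_on\<close>)
  with assms(3) show ?thesis by auto
qed

lemma closure_T_scaleC: "x \<in> closure T \<Longrightarrow> c *\<^sub>C x \<in> closure T"
  by (rule closure_T_map[OF bounded_linear_scaleC]) (simp_all add: T_scaleC closure_T_I)

lemma closure_T_add: "x \<in> closure T \<Longrightarrow> y \<in> closure T \<Longrightarrow> x + y \<in> closure T"
proof -
  assume "x \<in> closure T" "y \<in> closure T"
  then obtain f g where f: "\<And>n. f n \<in> T" "f \<longlonglongrightarrow> x" and g: "\<And>n. g n \<in> T" "g \<longlonglongrightarrow> y"
    by (auto simp: closure_sequential)
  then show ?thesis
    unfolding closure_sequential by (intro exI[of _ "\<lambda>n. f n + g n"]) (auto intro: T_add tendsto_add)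
qed

lemma R_P: "P \<in> R"
  unfolding R_def mem_Collect_eq
  by (rule ballI, rule closure_T_map[OF bounded_linear_mult_left]) (simp_all add: T_mult_P closure_T_I)

lemma R_B: "b \<in> B \<Longrightarrow> b \<in> R"
  unfolding R_def mem_Collect_eq
  by (rule ballI, rule closure_T_map[OF bounded_linear_mult_left]) (simp_all add: T_mult_B closure_T_I)

lemma R_add: "a \<in> R \<Longrightarrow> b \<in> R \<Longrightarrow> a + b \<in> R"
  by (simp add: R_def distrib_left closure_T_add)

lemma R_mult: "a \<in> R \<Longrightarrow> b \<in> R \<Longrightarrow> a * b \<in> R"
  by (simp add: R_def mult.assoc[symmetric])

lemma R_scaleC: "a \<in> R \<Longrightarrow> c *\<^sub>C a \<in> R"
  by (simp add: R_def mult_scaleC_right closure_T_scaleC)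

lemma R_one: "1 \<in> R"
  by (simp add: R_def)

lemma R_power: "a \<in> R \<Longrightarrow> a ^ n \<in> R"
  by (induction n) (simp_all add: R_one R_mult)

lemma R_sum: "(\<And>i. i \<in> I \<Longrightarrow> f i \<in> R) \<Longrightarrow> sum f I \<in> R"
proof (induction I rule: infinite_finite_induct)
  case (insert x F) then show ?case by (simp add: R_add)
qed (use R_scaleC[OF R_one, of 0] in auto)

lemma closed_R: "closed R"
proof -
  have "R = (\<Inter>x\<in>closure T. (\<lambda>a. x * a) -` closure T)"
    by (auto simp: R_def)
  moreover have "closed ((\<lambda>a. x * a) -` closure T)" for x
    by (intro closed_vimage closed_closure continuous_intros)
  ultimately show ?thesis by (metis (no_types, lifting) closed_INT)
qed

lemma R_suminf:
  assumes "summable f" "\<And>n. f n \<in> R"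
  shows "suminf f \<in> R"
  by (rule closed_sequentially[OF closed_R _ summable_LIMSEQ[OF assms(1)]]) (auto intro: R_sum assms(2))

lemma R_subset: "R \<subseteq> closure T"
  proof
  fix a assume "a \<in> R"
  moreover have "1 \<in> closure T"
    using T_base[OF subalgebra_one[OF B]] closure_subset by blast
  ultimately have "1 * a \<in> closure T"
    unfolding R_def by blast
  then show "a \<in> closure T" by simp
qed

end

section \<open>Moments of the semicircle law\<close>

text \<open>The integrand is odd: reflection turns the integral into its negative.\<close>

lemma semicircle_mean:
  "integral {- 2 * sqrt v .. 2 * sqrt v} (\<lambda>x. x ^ 1 * sqrt (4 * v - x\<^sup>2) / (2 * pi * v)) = 0"
proof -
  let ?f = "\<lambda>x. x ^ 1 * sqrt (4 * v - x\<^sup>2) / (2 * pi * v)"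
  have "integral {- (2 * sqrt v) .. - (- 2 * sqrt v)} (\<lambda>x. ?f (- x)) = integral {- 2 * sqrt v .. 2 * sqrt v} ?f"
    by (rule Henstock_Kurzweil_Integration.integral_reflect_real)
  then show ?thesis
    by simp
qed

lemma has_integral_semicircle_second_moment:
  fixes r :: real
  assumes r: "r > 0"
  shows "((\<lambda>x. x\<^sup>2 * sqrt (r\<^sup>2 - x\<^sup>2)) has_integral (r ^ 4 * pi / 8)) {-r..r}"
proof -
  \<comment> \<open>An antiderivative in closed form. Root and arcsin are not differentiable at the
    endpoints, hence the version of the fundamental theorem for the open interval; at the endpoints
    only arcsin = +-pi/2 contributes.\<close>
  define \<Phi> where "\<Phi> x = (x * (2 * x\<^sup>2 - r\<^sup>2) * sqrt (r\<^sup>2 - x\<^sup>2) + r ^ 4 * arcsin (x / r)) / 8" for x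
  have "((\<lambda>x. x\<^sup>2 * sqrt (r\<^sup>2 - x\<^sup>2)) has_integral (\<Phi> r - \<Phi> (- r))) {-r..r}"
  proof (rule fundamental_theorem_of_calculus_interior)
    show "continuous_on {- r..r} \<Phi>"
      unfolding \<Phi>_def using r by (intro continuous_intros) (auto simp: field_simps)
    fix x assume "x \<in> {- r<..<r}"
    then have x: "- r < x" "x < r" by auto
    define s where "s = sqrt (r\<^sup>2 - x\<^sup>2)"
    have pos: "r\<^sup>2 - x\<^sup>2 > 0"
      using power_strict_mono[of "\<bar>x\<bar>" r 2] x by simp
    then have s: "s > 0" "s * s = r\<^sup>2 - x\<^sup>2"
      by (simp_all add: s_def)
    have "1 - (x / r)\<^sup>2 = (r\<^sup>2 - x\<^sup>2) / r\<^sup>2"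
      using r by (simp add: field_simps)
    then have arc: "sqrt (1 - (x / r)\<^sup>2) = s / r"
      using r by (simp add: s_def real_sqrt_divide)
    have bd: "- 1 < x / r" "x / r < 1"
      using x r by (simp_all add: field_simps)
    have d1: "((\<lambda>x. x * (2 * x\<^sup>2 - r\<^sup>2)) has_real_derivative (6 * x\<^sup>2 - r\<^sup>2)) (at x)"
      by (auto intro!: derivative_eq_intros simp: power2_eq_square)
    have d2: "((\<lambda>x. sqrt (r\<^sup>2 - x\<^sup>2)) has_real_derivative (- x / s)) (at x)"
      using pos by (auto intro!: derivative_eq_intros simp: s_def field_simps)
    have d3: "((\<lambda>x. arcsin (x / r)) has_real_derivative (1 / s)) (at x)"
    proof -
      have "((\<lambda>x. x / r) has_real_derivative (1 / r)) (at x)"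
        by (rule DERIV_cdivide[OF DERIV_ident])
      note DERIV_chain2[where f = arcsin and g = "\<lambda>x. x / r", OF DERIV_arcsin[OF bd] this]
      then have "((\<lambda>x. arcsin (x / r)) has_real_derivative inverse (s / r) * (1 / r)) (at x)"
        unfolding arc .
      moreover have "inverse (s / r) * (1 / r) = 1 / s"
        using r s by simp
      ultimately show ?thesis
        by simp
    qed
    have "(\<Phi> has_real_derivative
        (((6 * x\<^sup>2 - r\<^sup>2) * sqrt (r\<^sup>2 - x\<^sup>2) + (- x / s) * (x * (2 * x\<^sup>2 - r\<^sup>2))) + r ^ 4 * (1 / s)) / 8) (at x)"
      unfolding \<Phi>_def by (rule DERIV_cdivide[OF DERIV_add[OF DERIV_mult[OF d1 d2] DERIV_cmult[OF d3]]])
    also have "(((6 * x\<^sup>2 - r\<^sup>2) * sqrt (r\<^sup>2 - x\<^sup>2) + (- x / s) * (x * (2 * x\<^sup>2 - r\<^sup>2))) + r ^ 4 * (1 / s)) / 8 =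
        ((6 * x\<^sup>2 - r\<^sup>2) * (s * s) - x\<^sup>2 * (2 * x\<^sup>2 - r\<^sup>2) + r ^ 4) / (8 * s)"
      unfolding s_def[symmetric] using s(1) by (simp add: field_simps power2_eq_square)
    also have "\<dots> = (8 * x\<^sup>2 * (s * s)) / (8 * s)"
      unfolding s(2) by (rule arg_cong[where f = "\<lambda>u. u / (8 * s)"]) algebra
    also have "\<dots> = x\<^sup>2 * sqrt (r\<^sup>2 - x\<^sup>2)"
      unfolding s_def[symmetric] using s(1) by simp
    finally show "(\<Phi> has_vector_derivative x\<^sup>2 * sqrt (r\<^sup>2 - x\<^sup>2)) (at x)"
      by (simp add: has_real_derivative_iff_has_vector_derivative)
  qed (use r in auto)
  moreover have "\<Phi> r - \<Phi> (- r) = r ^ 4 * pi / 8"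
    using r by (simp add: \<Phi>_def)
  ultimately show ?thesis by simp
qed

lemma semicircle_variance:
  assumes "v > 0"
  shows "integral {- 2 * sqrt v .. 2 * sqrt v} (\<lambda>x. x ^ 2 * sqrt (4 * v - x\<^sup>2) / (2 * pi * v)) = v"
proof -
  have "((\<lambda>x. x\<^sup>2 * sqrt ((2 * sqrt v)\<^sup>2 - x\<^sup>2) / (2 * pi * v)) has_integral
      ((2 * sqrt v) ^ 4 * pi / 8) / (2 * pi * v)) {- (2 * sqrt v)..2 * sqrt v}"
    by (intro has_integral_divide has_integral_semicircle_second_moment) (use assms in simp)
  moreover have "(2 * sqrt v)\<^sup>2 = 4 * v"
    using assms by (simp add: power_mult_distrib)
  moreover have "(2 * sqrt v) ^ 4 = 16 * v\<^sup>2"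
  proof -
    have "(2 * sqrt v) ^ 4 = ((2 * sqrt v)\<^sup>2)\<^sup>2" by simp
    also have "\<dots> = 16 * v\<^sup>2"
      unfolding \<open>(2 * sqrt v)\<^sup>2 = 4 * v\<close> by (simp add: power_mult_distrib)
    finally show ?thesis .
  qed
  ultimately show ?thesis
    using assms by (intro integral_unique) (simp add: power2_eq_square)
qed

lemma sum_lessThan_add:
  fixes f :: "nat \<Rightarrow> 'a::comm_monoid_add"
  shows "(\<Sum>i<m + k. f i) = (\<Sum>i<m. f i) + (\<Sum>i<k. f (m + i))"
  by (induction k) (simp_all add: add.assoc)

section \<open>Increments of the free unitary Brownian motion\<close>

lemma (in tracial_state) norm2_le_of_LIMSEQ:
  assumes "f \<longlonglongrightarrow> a" "\<forall>\<^sub>F n in sequentially. norm2 (f n) \<le> c"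
  shows "norm2 a \<le> c"
proof -
  have "(\<lambda>n. norm2 a - norm (a - f n)) \<longlonglongrightarrow> norm2 a - norm (a - a)"
    by (intro tendsto_intros assms)
  moreover have "\<forall>\<^sub>F n in sequentially. norm2 a - norm (a - f n) \<le> c"
    using assms(2)
  proof eventually_elim
    case (elim n)
    then show ?case
      using norm2_add_le[of "a - f n" "f n"] norm2_le_norm[of "a - f n"] by simp
  qed
  ultimately show ?thesis
    by (intro tendsto_upperbound[of _ "norm2 a"]) auto
qed

locale free_ubm = tracial_state \<tau> for \<tau> :: "'a::cstar_algebra \<Rightarrow> complex" +
  fixes F :: "real \<Rightarrow> 'a set" and X Y :: "real \<Rightarrow> 'a"
  assumes bm: "free_brownian_motion \<tau> F X"
    and adapted: "adapted F Y"
    and continuous: "continuous_on {0..} Y"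
    and unit: "\<And>t. t \<ge> 0 \<Longrightarrow> unitary (Y t)"
    and sde: "\<And>t. t \<ge> 0 \<Longrightarrow> \<exists>I. has_free_ito_integral Y X I 0 t \<and>
           Y t - Y 0 = \<i> *\<^sub>C I - (1/2) *\<^sub>R integral {0..t} Y"
begin

lemma F: "t \<ge> 0 \<Longrightarrow> star_subalgebra (F t)"
  and F_mono: "0 \<le> s \<Longrightarrow> s \<le> t \<Longrightarrow> F s \<subseteq> F t"
  and Y_F: "t \<ge> 0 \<Longrightarrow> Y t \<in> F t"
  and X_F: "t \<ge> 0 \<Longrightarrow> X t \<in> F t"
  using bm adapted unfolding free_brownian_motion_def filtration_def adapted_def by auto

lemma increment:
  assumes "0 \<le> s" "s < t"
  shows "star (X t - X s) = X t - X s" "\<tau> (X t - X s) = 0" "\<tau> ((X t - X s) * (X t - X s)) = t - s"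
    "star_free \<tau> {X t - X s} (F s)"
proof -
  have sc: "semicircular \<tau> (t - s) (X t - X s)" and "star_free \<tau> {X t - X s} (F s)"
    using bm assms unfolding free_brownian_motion_def by auto
  then show "star_free \<tau> {X t - X s} (F s)" "star (X t - X s) = X t - X s"
    by (auto simp: semicircular_def self_adjoint_def)
  have mom: "\<tau> ((X t - X s) ^ n) = complex_of_real (integral {- 2 * sqrt (t - s) .. 2 * sqrt (t - s)}
      (\<lambda>x. x ^ n * sqrt (4 * (t - s) - x\<^sup>2) / (2 * pi * (t - s))))" for n
    using sc by (auto simp: semicircular_def)
  show "\<tau> (X t - X s) = 0"
    using mom[of 1] unfolding semicircle_mean by simp
  show "\<tau> ((X t - X s) * (X t - X s)) = t - s"
  proof -
    have "t - s > 0" using assms by simp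
    from mom[of 2, unfolded semicircle_variance[OF this]] show ?thesis
      by (simp add: power2_eq_square)
  qed
qed

lemma increment_moments:
  assumes "0 \<le> s" "s < t" "a \<in> F s" "b \<in> F s"
  shows "\<tau> (a * (X t - X s)) = 0"
    "\<tau> (a * (X t - X s) * b * (X t - X s)) = \<tau> a * \<tau> b * (t - s)"
    "\<tau> (a * (X t - X s) * (X t - X s)) = \<tau> a * (t - s)"
  using free_pair_moments[OF increment(4)[OF assms(1,2)] F[OF assms(1)] increment(2)[OF assms(1,2)] assms(3,4)]
    increment(3)[OF assms(1,2)]
  by simp_all

lemma norm2_increment:
  assumes "0 \<le> s" "s < t"
  shows "norm2 (X t - X s) = sqrt (t - s)"
  using increment[OF assms] by (simp add: norm2_def)

section \<open>One time step: partition sums, drift and noise\<close>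

definition grid :: "real \<Rightarrow> real \<Rightarrow> nat \<Rightarrow> nat \<Rightarrow> real" where
  "grid t h N i = t + h * (real i / real N)"

definition ito_sum :: "real \<Rightarrow> real \<Rightarrow> nat \<Rightarrow> 'a" where
  "ito_sum t h N = (\<Sum>i<N. Y (grid t h N i) * (X (grid t h N (Suc i)) - X (grid t h N i)))"

definition drift :: "real \<Rightarrow> real \<Rightarrow> 'a" where
  "drift t h = integral {t..t + h} Y"

text \<open>By the equation this is i times the Ito integral over [t, t + h]. It is written through
  \<open>Y\<close> alone so that a functional vanishing on all values of \<open>Y\<close> visibly
  vanishes on it.\<close>

definition noise :: "real \<Rightarrow> real \<Rightarrow> 'a" where
  "noise t h = Y (t + h) - Y t + (1/2) *\<^sub>R drift t h"

lemma grid_less: "h > 0 \<Longrightarrow> N > 0 \<Longrightarrow> grid t h N i < grid t h N (Suc i)"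
  by (simp add: grid_def field_simps)

lemma grid_ge: "h > 0 \<Longrightarrow> t \<le> grid t h N i"
  by (simp add: grid_def)

lemma grid_le: "h > 0 \<Longrightarrow> i \<le> N \<Longrightarrow> grid t h N i \<le> t + h"
proof -
  assume "h > 0" "i \<le> N"
  then have "h * (real i / real N) \<le> h * 1"
    by (intro mult_left_mono) (auto simp: divide_le_eq_1)
  then show ?thesis
    by (simp add: grid_def)
qed

text \<open>The equation only supplies integrals starting at 0. The integral over [t, t + h] is
  their difference, taken along partitions that pass through \<open>t\<close>.\<close>

lemma ito_sum_LIMSEQ:
  assumes t: "t \<ge> 0" and h: "h > 0"
  shows "(\<lambda>N. \<i> *\<^sub>C ito_sum t h N) \<longlonglongrightarrow> noise t h"
proof -
  obtain I0 where I0: "has_free_ito_integral Y X I0 0 t" "Y t - Y 0 = \<i> *\<^sub>C I0 - (1/2) *\<^sub>R integral {0..t} Y"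
    using sde[OF t] by blast
  obtain I1 where I1: "has_free_ito_integral Y X I1 0 (t + h)"
    "Y (t + h) - Y 0 = \<i> *\<^sub>C I1 - (1/2) *\<^sub>R integral {0..t + h} Y"
    using sde[of "t + h"] t h by auto
  have K: "integral {0..t + h} Y = integral {0..t} Y + drift t h"
    unfolding drift_def
    by (rule Henstock_Kurzweil_Integration.integral_combine[symmetric])
      (use t h in \<open>auto intro!: integrable_continuous_interval continuous_on_subset[OF continuous]\<close>)
  have "noise t h = (Y (t + h) - Y 0) - (Y t - Y 0) + (1/2) *\<^sub>R drift t h"
    by (simp add: noise_def)
  then have noise: "noise t h = \<i> *\<^sub>C (I1 - I0)"
    by (simp add: I0(2) I1(2) K scaleC_diff_right scaleR_add_right)
  have "ito_sum t h \<longlonglongrightarrow> I1 - I0"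
  proof (rule LIMSEQ_I)
    fix e :: real assume e: "e > 0"
    then have e2: "e / 2 > 0" by simp
    obtain d0 where d0: "d0 > 0" "\<forall>n p. p 0 = 0 \<and> p n = t \<and>
        (\<forall>i<n. p i \<le> p (Suc i) \<and> p (Suc i) - p i < d0) \<longrightarrow>
        norm ((\<Sum>i<n. Y (p i) * (X (p (Suc i)) - X (p i))) - I0) < e / 2"
      using I0(1)[unfolded has_free_ito_integral_def, THEN spec, THEN mp, OF e2] by blast
    obtain d1 where d1: "d1 > 0" "\<forall>n p. p 0 = 0 \<and> p n = t + h \<and>
        (\<forall>i<n. p i \<le> p (Suc i) \<and> p (Suc i) - p i < d1) \<longrightarrow>
        norm ((\<Sum>i<n. Y (p i) * (X (p (Suc i)) - X (p i))) - I1) < e / 2"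
      using I1(1)[unfolded has_free_ito_integral_def, THEN spec, THEN mp, OF e2] by blast
    define d where "d = min d0 d1"
    have d: "d > 0" using d0 d1 by (simp add: d_def)
    obtain N0 :: nat where N0: "(t + h) / d < real N0"
      using reals_Archimedean2 by blast
    show "\<exists>no. \<forall>N\<ge>no. norm (ito_sum t h N - (I1 - I0)) < e"
    proof (intro exI[of _ "Suc N0"] allI impI)
      fix N assume N: "N \<ge> Suc N0"
      then have N_pos: "real N > 0" by simp
      have "(t + h) / d < real N"
        using N0 N by linarith
      then have mesh: "(t + h) / real N < d"
        using d N_pos by (simp add: field_simps)
      have mt: "t / real N < d" and mh: "h / real N < d"
        using mesh t h N_pos by (auto simp: field_simps intro: order_le_less_trans[rotated])
      \<comment> \<open>N equal steps on [0, t] followed by the grid on [t, t + h]. At i = N both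
        formulas give \<open>t\<close>, and the first N terms of the two sums cancel in the
        difference.\<close>
      define p where "p i = (if i \<le> N then t * (real i / real N) else grid t h N (i - N))" for i
      have pN: "p (N + i) = grid t h N i" for i
        using N_pos by (simp add: p_def grid_def)
      have step1: "p i \<le> p (Suc i) \<and> p (Suc i) - p i < d" if "i < N" for i
        using that t mt N_pos by (simp add: p_def field_simps)
      have step2: "p (N + i) \<le> p (Suc (N + i)) \<and> p (Suc (N + i)) - p (N + i) < d" for i
      proof -
        have "grid t h N (Suc i) = grid t h N i + h / real N"
          using N_pos by (simp add: grid_def field_simps)
        then show ?thesis
          using pN[of i] pN[of "Suc i"] h mh N_pos by simp
      qed
      have "norm ((\<Sum>i<N. Y (p i) * (X (p (Suc i)) - X (p i))) - I0) < e / 2"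
        by (rule d0(2)[THEN spec, THEN spec, THEN mp]) (use step1 N_pos in \<open>auto simp: p_def d_def\<close>)
      moreover have "norm ((\<Sum>i<N + N. Y (p i) * (X (p (Suc i)) - X (p i))) - I1) < e / 2"
      proof (rule d1(2)[THEN spec, THEN spec, THEN mp], intro conjI allI impI)
        show "p 0 = 0" by (simp add: p_def)
        show "p (N + N) = t + h" using pN[of N] N_pos by (simp add: grid_def)
        fix i assume "i < N + N"
        have "p i \<le> p (Suc i) \<and> p (Suc i) - p i < d"
          using step1[of i] step2[of "i - N"] by (cases "i < N") auto
        then show "p i \<le> p (Suc i)" "p (Suc i) - p i < d1"
          by (auto simp: d_def)
      qed
      moreover have "(\<Sum>i<N + N. Y (p i) * (X (p (Suc i)) - X (p i))) =
          (\<Sum>i<N. Y (p i) * (X (p (Suc i)) - X (p i))) + ito_sum t h N"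
        using pN[of "Suc i" for i] by (simp add: sum_lessThan_add ito_sum_def pN)
      ultimately show "norm (ito_sum t h N - (I1 - I0)) < e"
        using norm_triangle_ineq4[of "(\<Sum>i<N. Y (p i) * (X (p (Suc i)) - X (p i))) + ito_sum t h N - I1"
            "(\<Sum>i<N. Y (p i) * (X (p (Suc i)) - X (p i))) - I0"]
        by (simp add: algebra_simps)
    qed
  qed
  then show ?thesis
    unfolding noise by (intro bounded_linear.tendsto[OF bounded_linear_scaleC])
qed

text \<open>The martingale property: in each summand the left endpoint makes the coefficient
  adapted, and the increment is centred and free from it.\<close>

lemma tau_noise:
  assumes t: "t \<ge> 0" and h: "h > 0" and a: "a \<in> F t"
  shows "\<tau> (a * noise t h) = 0"
proof -
  have "\<tau> (a * (\<i> *\<^sub>C ito_sum t h N)) = 0" for N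
  proof -
    have "\<tau> (a * Y (grid t h N i) * (X (grid t h N (Suc i)) - X (grid t h N i))) = 0" if "i < N" for i
    proof (rule increment_moments(1)[OF _ _ _ subalgebra_one[OF F]])
      show g0: "0 \<le> grid t h N i" "0 \<le> grid t h N i"
        using grid_ge[OF h, of t N i] t by linarith+
      show "grid t h N i < grid t h N (Suc i)"
        using that h by (intro grid_less) auto
      show "a * Y (grid t h N i) \<in> F (grid t h N i)"
        using a F_mono[OF t grid_ge[OF h]] Y_F g0 by (intro subalgebra_mult F) auto
    qed
    then show ?thesis
      by (simp add: mult_scaleC_right tau_scaleC ito_sum_def sum_distrib_left linear_sum[OF tau_linear] mult.assoc)
  qed
  moreover have "(\<lambda>N. \<tau> (a * (\<i> *\<^sub>C ito_sum t h N))) \<longlonglongrightarrow> \<tau> (a * noise t h)"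
    by (intro bounded_linear.tendsto[OF bounded_linear_tau] tendsto_intros ito_sum_LIMSEQ t h)
  ultimately show ?thesis
    by (simp add: LIMSEQ_const_iff)
qed

text \<open>Ito isometry for the integrand \<open>Y s - Y t\<close>.\<close>

lemma norm2_noise:
  assumes t: "t \<ge> 0" and h: "h > 0" and osc: "\<And>s. s \<in> {t..t + h} \<Longrightarrow> norm (Y s - Y t) \<le> e"
  shows "norm2 (noise t h - \<i> *\<^sub>C (Y t * (X (t + h) - X t))) \<le> e * sqrt h"
proof (rule norm2_le_of_LIMSEQ)
  show "(\<lambda>N. \<i> *\<^sub>C ito_sum t h N - \<i> *\<^sub>C (Y t * (X (t + h) - X t))) \<longlonglongrightarrow>
      noise t h - \<i> *\<^sub>C (Y t * (X (t + h) - X t))"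
    by (intro tendsto_intros ito_sum_LIMSEQ t h)
  have "norm2 (\<i> *\<^sub>C ito_sum t h N - \<i> *\<^sub>C (Y t * (X (t + h) - X t))) \<le> e * sqrt h" if N: "N > 0" for N
  proof -
    define g where "g = grid t h N"
    define dX where "dX i = X (g (Suc i)) - X (g i)" for i
    define U where "U i = Y (g i) - Y t" for i
    define W where "W k = (\<Sum>i<k. U i * dX i)" for k
    have g0: "0 \<le> g i" "t \<le> g i" "g i < g (Suc i)" for i
      using grid_ge[OF h, of t N i] t grid_less[OF h N, of t i] by (auto simp: g_def)
    have e0: "e \<ge> 0"
      using osc[of t] h by simp
    have UF: "U i \<in> F (g i)" for i
      unfolding U_def using F_mono[OF t g0(2)] Y_F[OF t] Y_F[OF g0(1)] F[OF g0(1)]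
      by (intro subalgebra_diff) auto
    have dXF: "dX i \<in> F (g (Suc i))" for i
      unfolding dX_def using F_mono[OF g0(1), of i "g (Suc i)"] X_F[OF g0(1)] F[OF g0(1)] g0(3)[of i]
      by (intro subalgebra_diff) auto
    have WF: "W k \<in> F (g k)" for k
    proof (induction k)
      case (Suc k)
      have "F (g k) \<subseteq> F (g (Suc k))"
        using g0(1,3)[of k] by (intro F_mono) auto
      with Suc UF[of k] dXF[of k] F[OF g0(1)] show ?case
        unfolding W_def by (auto intro!: subalgebra_add subalgebra_mult)
    qed (simp add: W_def subalgebra_zero[OF F[OF g0(1)]])
    \<comment> \<open>Pythagoras step by step: \<open>W k\<close> and \<open>U k\<close> lie in the
      past of the next increment, so the cross terms vanish and each step adds only its own
      square.\<close>
    have iso: "(norm2 (W k))\<^sup>2 \<le> e\<^sup>2 * (g k - t)" if "k \<le> N" for k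
      using that
    proof (induction k)
      case 0
      then show ?case by (simp add: W_def norm2_def g_def grid_def)
    next
      case (Suc k)
      have star_dX: "star (dX k) = dX k"
        unfolding dX_def by (rule increment(1)[OF g0(1,3)])
      have "star (W (Suc k)) * W (Suc k) = star (W k) * W k + star (W k) * U k * dX k
          + (star (star (W k) * U k * dX k) + dX k * star (U k) * U k * dX k)"
        by (simp add: W_def star_add star_mult star_star star_dX distrib_left distrib_right mult.assoc)
      then have "\<tau> (star (W (Suc k)) * W (Suc k)) = \<tau> (star (W k) * W k) + \<tau> (star (W k) * U k * dX k)
          + (cnj (\<tau> (star (W k) * U k * dX k)) + \<tau> (dX k * star (U k) * U k * dX k))"
        by (simp add: tau_add tau_star)
      also have "\<tau> (star (W k) * U k * dX k) = 0"
        unfolding dX_def by (rule increment_moments(1)[OF g0(1,3) _ subalgebra_one[OF F[OF g0(1)]]])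
            (intro subalgebra_mult subalgebra_star F[OF g0(1)] WF UF)
      also have "\<tau> (dX k * star (U k) * U k * dX k) = \<tau> (star (U k) * U k * dX k * dX k)"
        using tau_commute[of "dX k" "star (U k) * U k * dX k"] by (simp add: mult.assoc)
      also have "\<dots> = \<tau> (star (U k) * U k) * (g (Suc k) - g k)"
        unfolding dX_def by (rule increment_moments(3)[OF g0(1,3) _ subalgebra_one[OF F[OF g0(1)]]])
            (intro subalgebra_mult subalgebra_star F[OF g0(1)] UF)
      finally have "complex_of_real ((norm2 (W (Suc k)))\<^sup>2) =
          complex_of_real ((norm2 (W k))\<^sup>2 + (norm2 (U k))\<^sup>2 * (g (Suc k) - g k))"
        unfolding norm2_square[symmetric] by simp
      then have "(norm2 (W (Suc k)))\<^sup>2 = (norm2 (W k))\<^sup>2 + (norm2 (U k))\<^sup>2 * (g (Suc k) - g k)"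
        unfolding of_real_eq_iff .
      moreover have "(norm2 (U k))\<^sup>2 * (g (Suc k) - g k) \<le> e\<^sup>2 * (g (Suc k) - g k)"
      proof -
        have "g k \<in> {t..t + h}"
          using g0[of k] grid_le[OF h, of k N t] Suc.prems by (auto simp: g_def)
        then have "norm2 (U k) \<le> e"
          unfolding U_def using norm2_le_norm[of "Y (g k) - Y t"] osc[of "g k"] by linarith
        then show ?thesis
          using g0(3)[of k] by (intro mult_right_mono power_mono) auto
      qed
      moreover have "(norm2 (W k))\<^sup>2 \<le> e\<^sup>2 * (g k - t)"
        using Suc by simp
      ultimately show ?case
        by (simp add: algebra_simps)
    qed
    have "(\<Sum>i<N. dX i) = X (g N) - X (g 0)"
      unfolding dX_def by (rule sum_lessThan_telescope)
    also have "\<dots> = X (t + h) - X t"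
      using N by (simp add: g_def grid_def)
    finally have "ito_sum t h N - Y t * (X (t + h) - X t) = W N"
      by (simp add: W_def U_def ito_sum_def dX_def g_def sum_distrib_left sum_subtractf left_diff_distrib
          flip: sum_distrib_left)
    then have "norm2 (\<i> *\<^sub>C ito_sum t h N - \<i> *\<^sub>C (Y t * (X (t + h) - X t))) = norm2 (W N)"
      by (simp add: scaleC_diff_right[symmetric] norm2_scaleC)
    also have "(norm2 (W N))\<^sup>2 \<le> (e * sqrt h)\<^sup>2"
      using iso[of N] N h by (simp add: g_def grid_def power_mult_distrib)
    then have "norm2 (W N) \<le> e * sqrt h"
      using e0 h by (intro power2_le_imp_le[of "norm2 (W N)"]) auto
    finally show ?thesis .
  qed
  then show "\<forall>\<^sub>F N in sequentially. norm2 (\<i> *\<^sub>C ito_sum t h N - \<i> *\<^sub>C (Y t * (X (t + h) - X t))) \<le> e * sqrt h"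
    using eventually_gt_at_top by (rule eventually_mono[rotated])
qed

end

text \<open>An epsilon/3 argument: the bound by \<open>K\<close> is uniform in h > 0, so
  approximating \<open>x\<close> from \<open>T\<close> costs the same at every h.\<close>

lemma tendsto_at_right_closure:
  fixes f :: "real \<Rightarrow> 'a::real_normed_vector \<Rightarrow> 'b::real_normed_vector"
  assumes bound: "\<And>h x. h > 0 \<Longrightarrow> norm (f h x) \<le> K * norm x"
    and diff: "\<And>h x y. f h (x - y) = f h x - f h y"
    and L_bound: "\<And>x. norm (L x) \<le> K * norm x" and L_diff: "\<And>x y. L (x - y) = L x - L y"
    and lim: "\<And>x. x \<in> T \<Longrightarrow> ((\<lambda>h. f h x) \<longlongrightarrow> L x) (at_right 0)"
    and x: "x \<in> closure T"
  shows "((\<lambda>h. f h x) \<longlongrightarrow> L x) (at_right 0)"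
proof (rule tendstoI)
  fix e :: real assume e: "e > 0"
  define k where "k = \<bar>K\<bar> + 1"
  define d where "d = e / (3 * k)"
  have k: "k > 0" "K \<le> k"
    by (auto simp: k_def)
  have "d > 0"
    using e k by (simp add: d_def)
  then obtain y where y: "y \<in> T" "norm (x - y) < d"
    using x unfolding closure_approachable by (metis dist_commute dist_norm)
  have K: "K * norm (x - y) < e / 3"
  proof -
    have "K * norm (x - y) \<le> k * norm (x - y)"
      using k by (intro mult_right_mono) auto
    also have "\<dots> < k * d"
      using y k by (intro mult_strict_left_mono) auto
    also have "\<dots> = e / 3"
      using k by (simp add: d_def)
    finally show ?thesis .
  qed
  have "\<forall>\<^sub>F h in at_right 0. dist (f h y) (L y) < e / 3"
    using tendstoD[OF lim[OF y(1)], of "e / 3"] e by simp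
  moreover have "\<forall>\<^sub>F h in at_right (0::real). h > 0"
    by (rule eventually_at_right_less)
  ultimately show "\<forall>\<^sub>F h in at_right 0. dist (f h x) (L x) < e"
  proof eventually_elim
    case (elim h)
    have "norm (f h x - f h y) < e / 3" "norm (L x - L y) < e / 3"
      using bound[OF elim(2), of "x - y"] L_bound[of "x - y"] K unfolding diff L_diff by linarith+
    moreover have "norm (f h x - L x) \<le> norm (f h x - f h y) + norm (f h y - L y) + norm (L x - L y)"
      using norm_triangle_ineq4[of "f h x - f h y + (f h y - L y)" "L x - L y"]
        norm_triangle_ineq[of "f h x - f h y" "f h y - L y"] by simp
    ultimately show ?case
      using elim(1) by (simp add: dist_norm)
  qed
qed

section \<open>A projection free from the Brownian motion\<close>

locale projection_ubm = free_ubm \<tau> F X Y for \<tau> :: "'a::cstar_algebra \<Rightarrow> complex" and F X Y +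
  fixes P :: 'a
  assumes proj: "projection P" and free: "star_free \<tau> {P} (Y ` {0..})"
begin

definition C :: "'a set" where
  "C = star_subalgebra hull (Y ` {0..})"

lemma C: "star_subalgebra C"
  unfolding C_def by (rule star_subalgebra_hull)

lemma Y_C: "s \<ge> 0 \<Longrightarrow> Y s \<in> C"
  unfolding C_def by (rule hull_inc) simp

end

locale projection_ubm_at = projection_ubm \<tau> F X Y P for \<tau> :: "'a::cstar_algebra \<Rightarrow> complex" and F X Y P +
  fixes t :: real
  assumes t: "t \<ge> 0"
begin

text \<open>The coefficient algebra is the past cut down to \<open>C\<close>: lying in
  \<open>F t\<close> gives freeness from the later increments of \<open>X\<close>, lying in
  \<open>C\<close> gives freeness from \<open>P\<close>.\<close>

sublocale free_projection \<tau> P "F t \<inter> C" C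
proof
  show "star_free \<tau> {P} C"
    using free unfolding star_free_def C_def hull_star_subalgebra[OF star_subalgebra_hull] .
qed (use proj t F C in \<open>auto intro!: star_subalgebra_Int\<close>)

text \<open>The Boolean selects the process or its adjoint, so that one statement covers every
  pattern of increments and adjoint increments.\<close>

definition Z :: "bool \<Rightarrow> real \<Rightarrow> 'a" where
  "Z e s = (if e then Y s else star (Y s))"

definition dZ :: "bool \<Rightarrow> real \<Rightarrow> 'a" where
  "dZ e h = Z e (t + h) - Z e t"

lemma norm_Z: "s \<ge> 0 \<Longrightarrow> norm (Z e s) = 1"
  using norm_unitary[OF unit] by (simp add: Z_def)

lemma Z_C: "s \<ge> 0 \<Longrightarrow> Z e s \<in> C"
  by (auto simp: Z_def intro: Y_C subalgebra_star[OF C])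

lemma Z_B: "Z e t \<in> F t \<inter> C"
  using t by (auto simp: Z_def intro: Y_C subalgebra_star[OF C] Y_F subalgebra_star[OF F])

lemma dZ_C: "h > 0 \<Longrightarrow> dZ e h \<in> C"
  unfolding dZ_def using t by (intro subalgebra_diff C Z_C) auto

lemma dZ_star: "dZ e h = (if e then dZ True h else star (dZ True h))"
  by (simp add: dZ_def Z_def star_diff)

lemma eventually_oscillation:
  assumes "e > 0"
  shows "\<forall>\<^sub>F h in at_right 0. \<forall>s\<in>{t..t + h}. norm (Y s - Y t) \<le> e"
proof -
  obtain d where d: "d > 0" "\<And>s. s \<in> {0..} \<Longrightarrow> dist s t < d \<Longrightarrow> dist (Y s) (Y t) < e"
    using continuous t assms unfolding continuous_on_iff by (metis atLeast_iff)
  show ?thesis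
    unfolding eventually_at_right_field
    using d t by (intro exI[of _ d]) (auto simp: dist_norm intro!: less_imp_le)
qed

lemma dZ_tendsto: "(dZ e \<longlongrightarrow> 0) (at_right 0)"
proof -
  have "((\<lambda>h. norm (dZ True h)) \<longlongrightarrow> 0) (at_right 0)"
  proof (rule tendstoI)
    fix r :: real assume "r > 0"
    with eventually_oscillation[of "r / 2"] have "\<forall>\<^sub>F h in at_right 0. \<forall>s\<in>{t..t + h}. norm (Y s - Y t) \<le> r / 2"
      by simp
    moreover have "\<forall>\<^sub>F h in at_right (0::real). h > 0"
      by (rule eventually_at_right_less)
    ultimately show "\<forall>\<^sub>F h in at_right 0. dist (norm (dZ True h)) 0 < r"
    proof eventually_elim
      case (elim h)
      then have "norm (Y (t + h) - Y t) \<le> r / 2" by auto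
      with \<open>r > 0\<close> show ?case by (simp add: dZ_def Z_def)
    qed
  qed
  then have "((\<lambda>h. norm (dZ e h)) \<longlongrightarrow> 0) (at_right 0)"
    by (cases e) (simp_all add: dZ_star[of False])
  then show ?thesis
    by (simp add: tendsto_norm_zero_iff)
qed

lemma continuous_interval: "continuous_on {t..t + h} Y"
  by (rule continuous_on_subset[OF continuous]) (use t in auto)

lemma integrable_interval: "Y integrable_on {t..t + h}"
  by (rule integrable_continuous_interval[OF continuous_interval])

lemma norm_drift: "h > 0 \<Longrightarrow> norm (drift t h) \<le> h"
  using integral_bound[of t "t + h" Y 1] continuous_interval norm_unitary[OF unit] t
  by (simp add: drift_def)

lemma drift_tendsto: "((\<lambda>h. (1 / h) *\<^sub>R drift t h) \<longlongrightarrow> Y t) (at_right 0)"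
proof (rule tendstoI)
  fix r :: real assume r: "r > 0"
  with eventually_oscillation[of "r / 2"] have "\<forall>\<^sub>F h in at_right 0. \<forall>s\<in>{t..t + h}. norm (Y s - Y t) \<le> r / 2"
    by simp
  moreover have "\<forall>\<^sub>F h in at_right (0::real). h > 0"
    by (rule eventually_at_right_less)
  ultimately show "\<forall>\<^sub>F h in at_right 0. dist ((1 / h) *\<^sub>R drift t h) (Y t) < r"
  proof eventually_elim
    case (elim h)
    have "integral {t..t + h} (\<lambda>s. Y s - Y t) = drift t h - h *\<^sub>R Y t"
      using elim(2) by (subst integral_diff) (auto simp: drift_def integrable_interval)
    moreover have "norm (integral {t..t + h} (\<lambda>s. Y s - Y t)) \<le> r / 2 * (t + h - t)"
      using elim by (intro integral_bound continuous_intros continuous_interval) auto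
    ultimately have "norm (drift t h - h *\<^sub>R Y t) \<le> r / 2 * h"
      by simp
    moreover have "(1 / h) *\<^sub>R drift t h - Y t = (1 / h) *\<^sub>R (drift t h - h *\<^sub>R Y t)"
      using elim(2) by (simp add: scaleR_diff_right)
    ultimately have "norm ((1 / h) *\<^sub>R drift t h - Y t) \<le> r / 2"
      using elim(2) by (simp add: divide_simps)
    with r show ?case
      by (simp add: dist_norm)
  qed
qed

text \<open>A substitute for membership: the drift is an integral, hence only a norm limit, and need
  not lie in \<open>C\<close>. Bounded functionals commute with the integral.\<close>

lemma noise_zero:
  assumes f: "bounded_linear f" and Y0: "\<And>s. s \<ge> 0 \<Longrightarrow> f (Y s) = (0::complex)" and h: "h > 0"
  shows "f (noise t h) = 0"
proof -
  interpret f: bounded_linear f by fact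
  have "f (drift t h) = integral {t..t + h} (f \<circ> Y)"
    unfolding drift_def by (rule integral_linear[OF integrable_interval f, symmetric])
  also have "\<dots> = integral {t..t + h} (\<lambda>_. 0)"
    using t by (intro integral_cong) (simp add: Y0)
  finally have "f (drift t h) = 0" by simp
  then show ?thesis
    using t h by (simp add: noise_def f.add f.diff f.scaleR Y0)
qed

text \<open>Two different reasons: for coefficients in the past the martingale property, for words
  containing \<open>p\<close> the freeness of \<open>P\<close>, which makes the functional vanish on
  \<open>C\<close>. Linearity and continuity do the rest.\<close>

lemma tau_closure_noise:
  assumes h: "h > 0" and a: "a \<in> closure T"
  shows "\<tau> (a * (if e then noise t h else star (noise t h))) = 0"
proof -
  have 1: "\<tau> (a * (if e then noise t h else star (noise t h))) = 0" if "a \<in> T" for a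
    using that
  proof (induction rule: T.induct)
    case (T_base b)
    have "\<tau> (b * star (noise t h)) = cnj (\<tau> (star b * noise t h))"
      by (simp add: tau_star[symmetric] star_mult star_star tau_commute)
    then show ?case
      using T_base tau_noise[OF t h, of b] tau_noise[OF t h, of "star b"] subalgebra_star[OF F[OF t], of b] by simp
  next
    case (T_word b v c)
    have "\<tau> (b * v * c * noise t h) = 0"
      by (rule noise_zero[where f = "\<lambda>x. \<tau> (b * v * c * x)", OF _ _ h])
        (use T_word Y_C in \<open>auto intro!: tau_word bounded_linear_compose[OF bounded_linear_tau bounded_linear_mult_right]\<close>)
    moreover have "\<tau> (b * v * c * star (noise t h)) = 0"
      by (rule noise_zero[where f = "\<lambda>x. \<tau> (b * v * c * star x)", OF _ _ h])
        (use T_word Y_C in \<open>auto intro!: tau_word subalgebra_star[OF C] bounded_linear_compose[OF bounded_linear_tau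
          bounded_linear_compose[OF bounded_linear_mult_right bounded_linear_star]]\<close>)
    ultimately show ?case by simp
  qed (simp_all add: distrib_right tau_add)
  have "closed {a. \<tau> (a * (if e then noise t h else star (noise t h))) = 0}"
    by (intro closed_Collect_eq continuous_intros
        linear_continuous_on[OF bounded_linear_compose[OF bounded_linear_tau bounded_linear_mult_left]])
  then have "closure T \<subseteq> {a. \<tau> (a * (if e then noise t h else star (noise t h))) = 0}"
    by (intro closure_minimal) (use 1 in auto)
  with a show ?thesis by auto
qed

text \<open>The increment is noise minus half the drift. The noise has trace zero against
  \<open>a\<close>, so only the averaged drift remains.\<close>

lemma first_order:
  assumes a: "a \<in> closure T"
  shows "((\<lambda>h. \<tau> (a * dZ e h) / h) \<longlongrightarrow> - \<tau> (a * Z e t) / 2) (at_right 0)"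
proof (rule Lim_transform_eventually)
  define g where "g x = (if e then x else star x)" for x :: 'a
  have bl: "bounded_linear g"
    unfolding g_def by (cases e) (simp_all add: bounded_linear_star bounded_linear_ident)
  interpret g: bounded_linear g by (rule bl)
  have "((\<lambda>h. - \<tau> (a * g ((1 / h) *\<^sub>R drift t h)) / 2) \<longlongrightarrow> - \<tau> (a * g (Y t)) / 2) (at_right 0)"
    by (intro tendsto_intros bounded_linear.tendsto[OF bounded_linear_tau] g.tendsto drift_tendsto) simp
  then show "((\<lambda>h. - \<tau> (a * g ((1 / h) *\<^sub>R drift t h)) / 2) \<longlongrightarrow> - \<tau> (a * Z e t) / 2) (at_right 0)"
    by (simp add: g_def Z_def)
  have "\<forall>\<^sub>F h in at_right (0::real). h > 0"
    by (rule eventually_at_right_less)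
  then show "\<forall>\<^sub>F h in at_right 0. - \<tau> (a * g ((1 / h) *\<^sub>R drift t h)) / 2 = \<tau> (a * dZ e h) / h"
  proof eventually_elim
    case (elim h)
    have "dZ e h = g (noise t h) - (1/2) *\<^sub>R g (drift t h)"
      by (simp add: noise_def g.add g.scaleR g.diff) (simp add: g_def dZ_def Z_def)
    moreover have "\<tau> (a * g (noise t h)) = 0"
      using tau_closure_noise[OF elim a, of e] by (simp add: g_def if_distrib)
    ultimately show ?case
      by (simp add: g.scaleR right_diff_distrib tau_diff tau_scaleR)
  qed
qed

text \<open>Unitarity reduces the square to 2 - 2 Re \<tau> w. Inserting noise and drift into
  \<open>w\<close> leaves exactly the trace of star (Y t) times the drift, which is at most
  h.\<close>

lemma norm2_dZ:
  assumes h: "h > 0"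
  shows "norm2 (dZ e h) \<le> sqrt h"
proof -
  have u: "star (Y t) * Y t = 1" "star (Y (t + h)) * Y (t + h) = 1"
    using unit[of t] unit[of "t + h"] t h by (auto simp: unitary_def)
  define w where "w = star (Y t) * Y (t + h)"
  have "star (dZ True h) * dZ True h = 2 - w - star w"
    by (simp add: dZ_def Z_def star_diff left_diff_distrib right_diff_distrib u w_def star_mult star_star)
  then have "(norm2 (dZ True h))\<^sup>2 = 2 - 2 * Re (\<tau> w)"
    using tau_scaleR[of 2 1] by (simp add: norm2_square' tau_diff tau_star scaleR_2 tau_add)
  also have "\<tau> w = \<tau> (star (Y t) * noise t h) + \<tau> (star (Y t) * Y t) - \<tau> (star (Y t) * drift t h) / 2"
    by (simp add: w_def noise_def algebra_simps tau_add tau_diff tau_scaleR)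
  also have "\<tau> (star (Y t) * noise t h) = 0"
    by (rule tau_noise[OF t h]) (intro subalgebra_star F Y_F t)
  finally have "(norm2 (dZ True h))\<^sup>2 = Re (\<tau> (star (Y t) * drift t h))"
    by (simp add: u)
  also have "\<dots> \<le> norm (star (Y t) * drift t h)"
    using complex_Re_le_cmod tau_bound order_trans by blast
  also have "\<dots> \<le> norm (star (Y t)) * norm (drift t h)"
    by (rule norm_mult_ineq)
  also have "\<dots> \<le> h"
    using norm_drift[OF h] norm_unitary[OF unit[OF t]] by simp
  finally have "norm2 (dZ True h) \<le> sqrt h"
    by (rule real_le_rsqrt)
  then show ?thesis
    by (subst dZ_star) simp
qed

text \<open>The increment with its coefficient frozen at time \<open>t\<close>. It contains a single
  increment of \<open>X\<close>, so its second moments are known exactly.\<close>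

definition white :: "bool \<Rightarrow> real \<Rightarrow> 'a" where
  "white e h = (if e then \<i> *\<^sub>C (Y t * (X (t + h) - X t)) else star (\<i> *\<^sub>C (Y t * (X (t + h) - X t))))"

lemma norm2_white: "h > 0 \<Longrightarrow> norm2 (white e h) \<le> sqrt h"
  using norm2_mult_left[of "Y t" "X (t + h) - X t"] norm2_increment[of t "t + h"] t norm_unitary[OF unit[OF t]]
  by (simp add: white_def norm2_scaleC)

text \<open>Freezing the coefficient costs the oscillation of \<open>Y\<close> on [t, t + h] times
  sqrt h, by the Ito isometry; the drift costs only O(h). Both are o(sqrt h).\<close>

lemma white_approx: "((\<lambda>h. norm2 (dZ e h - white e h) / sqrt h) \<longlongrightarrow> 0) (at_right 0)"
proof -
  have "((\<lambda>h. norm2 (dZ True h - white True h) / sqrt h) \<longlongrightarrow> 0) (at_right 0)"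
  proof (rule tendstoI)
    fix r :: real assume r: "r > 0"
    with eventually_oscillation[of "r / 2"] have "\<forall>\<^sub>F h in at_right 0. \<forall>s\<in>{t..t + h}. norm (Y s - Y t) \<le> r / 2"
      by simp
    moreover have "\<forall>\<^sub>F h in at_right (0::real). h > 0"
      by (rule eventually_at_right_less)
    moreover have "\<forall>\<^sub>F h in at_right (0::real). h < r\<^sup>2"
      using r by (simp add: eventually_at_right_field) (metis zero_less_power)
    ultimately show "\<forall>\<^sub>F h in at_right 0. dist (norm2 (dZ True h - white True h) / sqrt h) 0 < r"
    proof eventually_elim
      case (elim h)
      have eq: "dZ True h - white True h = (noise t h - white True h) + - ((1/2) *\<^sub>R drift t h)"
        by (simp add: noise_def dZ_def Z_def)
      have "norm2 (dZ True h - white True h) \<le> norm2 (noise t h - white True h) + norm2 ((1/2) *\<^sub>R drift t h)"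
        using norm2_add_le[of "noise t h - white True h" "- ((1/2) *\<^sub>R drift t h)"]
        by (simp only: eq norm2_minus)
      also have "norm2 ((1/2) *\<^sub>R drift t h) \<le> h / 2"
        using norm2_le_norm[of "(1/2) *\<^sub>R drift t h"] norm_drift[OF elim(2)] by simp
      also have "norm2 (noise t h - white True h) \<le> r / 2 * sqrt h"
        using norm2_noise[OF t elim(2), of "r / 2"] elim(1) by (simp add: white_def)
      also have "h / 2 = sqrt h / 2 * sqrt h"
        using elim(2) by simp
      finally have "norm2 (dZ True h - white True h) / sqrt h \<le> r / 2 + sqrt h / 2"
        using elim(2) by (simp add: field_simps)
      also have "sqrt h < r"
        using elim(3) r real_less_lsqrt[of r h] by simp
      finally show ?case
        using elim(2) by simp
    qed
  qed
  moreover have "norm2 (dZ e h - white e h) = norm2 (dZ True h - white True h)" for h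
  proof (cases e)
    case False
    then have "dZ e h - white e h = star (dZ True h - white True h)"
      by (simp add: star_diff white_def dZ_star[of False])
    then show ?thesis by simp
  qed simp
  ultimately show ?thesis by simp
qed

text \<open>The Ito rule for the two increments. The sign is i * i = -1 for equal types and i * (-i)
  = 1 for an increment paired with an adjoint one.\<close>

definition covariation :: "bool \<Rightarrow> bool \<Rightarrow> 'a \<Rightarrow> 'a \<Rightarrow> complex" where
  "covariation e f a b = (if e = f then - (\<tau> (a * Z e t) * \<tau> (b * Z f t)) else \<tau> a * \<tau> b)"

text \<open>An exact identity, from the second moment of a free increment. For mixed types
  \<open>Y t\<close> and its adjoint end up around one coefficient and cancel under the trace by
  unitarity.\<close>

lemma tau_white:
  assumes a: "a \<in> F t" and b: "b \<in> F t" and h: "h > 0"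
  shows "\<tau> (a * white e h * b * white f h) = covariation e f a b * h"
proof -
  define x where "x = X (t + h) - X t"
  have sx: "star x = x"
    using increment(1)[OF t, of "t + h"] h by (simp add: x_def)
  have w: "white True h = \<i> *\<^sub>C (Y t * x)" "white False h = (- \<i>) *\<^sub>C (x * star (Y t))"
    by (simp_all add: white_def x_def[symmetric] star_scaleC star_mult sx)
  have mom: "\<tau> (c * x * d * x) = \<tau> c * \<tau> d * h" if "c \<in> F t" "d \<in> F t" for c d
    using increment_moments(2)[OF t _ that, of "t + h"] h by (simp add: x_def)
  have Y: "Y t \<in> F t" "star (Y t) \<in> F t"
    using Y_F[OF t] subalgebra_star[OF F[OF t]] by auto
  have TF: "\<tau> (a * white True h * b * white False h) = \<tau> a * \<tau> b * h" if "a \<in> F t" "b \<in> F t" for a b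
  proof -
    have "\<tau> (a * white True h * b * white False h) = \<tau> (a * Y t * x * b * x * star (Y t))"
      by (simp add: w mult_scaleC_left mult_scaleC_right tau_scaleC scaleC_scaleC mult.assoc)
    also have "\<dots> = \<tau> (star (Y t) * a * Y t * x * b * x)"
      using tau_commute[of "a * Y t * x * b * x" "star (Y t)"] by (simp add: mult.assoc)
    also have "\<dots> = \<tau> (star (Y t) * a * Y t) * \<tau> b * h"
      using that Y by (intro mom subalgebra_mult F t) auto
    also have "\<tau> (star (Y t) * a * Y t) = \<tau> a"
      using tau_commute[of "star (Y t)" "a * Y t"] unit[OF t] by (simp add: mult.assoc unitary_def)
    finally show ?thesis .
  qed
  consider "e" "f" | "e" "\<not> f" | "\<not> e" "f" | "\<not> e" "\<not> f" by blast
  then show ?thesis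
  proof cases
    case 1
    have "\<tau> (a * white True h * b * white True h) = - \<tau> (a * Y t * x * (b * Y t) * x)"
      by (simp add: w mult_scaleC_left mult_scaleC_right tau_scaleC scaleC_scaleC mult.assoc)
    also have "\<dots> = - (\<tau> (a * Y t) * \<tau> (b * Y t) * h)"
      using a b Y by (subst mom) (auto intro!: subalgebra_mult F t)
    finally show ?thesis
      using 1 by (simp add: covariation_def Z_def)
  next
    case 2
    then show ?thesis
      using TF[OF a b] by (simp add: covariation_def)
  next
    case 3
    have "\<tau> (a * white False h * b * white True h) = \<tau> (b * white True h * a * white False h)"
      using tau_commute[of "a * white False h" "b * white True h"] by (simp add: mult.assoc)
    then show ?thesis
      using 3 TF[OF b a] by (simp add: covariation_def)
  next
    case 4
    have "\<tau> (a * white False h * b * white False h) = - \<tau> (a * x * star (Y t) * b * x * star (Y t))"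
      by (simp add: w mult_scaleC_left mult_scaleC_right tau_scaleC scaleC_scaleC mult.assoc)
    also have "\<tau> (a * x * star (Y t) * b * x * star (Y t)) = \<tau> (star (Y t) * a * x * (star (Y t) * b) * x)"
      using tau_commute[of "a * x * star (Y t) * b * x" "star (Y t)"] by (simp add: mult.assoc)
    also have "\<dots> = \<tau> (star (Y t) * a) * \<tau> (star (Y t) * b) * h"
      using a b Y by (intro mom subalgebra_mult F t) auto
    finally show ?thesis
      using 4 by (simp add: covariation_def Z_def tau_commute[of _ "star (Y t)"])
  qed
qed

text \<open>The increments are replaced by their frozen versions one at a time; each replacement
  costs sqrt h times o(sqrt h).\<close>

lemma second_order_past:
  assumes a: "a \<in> F t" and b: "b \<in> F t"
  shows "((\<lambda>h. \<tau> (a * dZ e h * b * dZ f h) / h) \<longlongrightarrow> covariation e f a b) (at_right 0)"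
proof -
  define r where "r h = norm2 (dZ e h - white e h) / sqrt h + norm2 (dZ f h - white f h) / sqrt h" for h
  have r: "((\<lambda>h. norm a * norm b * r h) \<longlongrightarrow> 0) (at_right 0)"
    using tendsto_mult[OF tendsto_const tendsto_add[OF white_approx[of e] white_approx[of f]]]
    unfolding r_def by simp
  have "((\<lambda>h. \<tau> (a * dZ e h * b * dZ f h) / h - covariation e f a b) \<longlongrightarrow> 0) (at_right 0)"
  proof (rule Lim_null_comparison[OF _ r])
    have "\<forall>\<^sub>F h in at_right (0::real). h > 0"
      by (rule eventually_at_right_less)
    then show "\<forall>\<^sub>F h in at_right 0. cmod (\<tau> (a * dZ e h * b * dZ f h) / h - covariation e f a b) \<le> norm a * norm b * r h"
    proof eventually_elim
      case (elim h)
      let ?n = "norm a * norm b"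
      have eq: "\<tau> (a * dZ e h * b * dZ f h) - covariation e f a b * h =
          \<tau> (a * dZ e h * b * (dZ f h - white f h)) + \<tau> (a * (dZ e h - white e h) * b * white f h)"
        unfolding tau_white[OF a b elim, symmetric] by (simp add: algebra_simps tau_diff)
      have "cmod (\<tau> (a * dZ e h * b * dZ f h) - covariation e f a b * h) \<le>
          ?n * (norm2 (dZ e h) * norm2 (dZ f h - white f h)) + ?n * (norm2 (dZ e h - white e h) * norm2 (white f h))"
        unfolding eq by (intro norm_triangle_mono tau_two_noise_bound)
      also have "\<dots> \<le> ?n * (sqrt h * norm2 (dZ f h - white f h)) + ?n * (norm2 (dZ e h - white e h) * sqrt h)"
      proof (rule add_mono)
        show "?n * (norm2 (dZ e h) * norm2 (dZ f h - white f h)) \<le> ?n * (sqrt h * norm2 (dZ f h - white f h))"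
          by (rule mult_left_mono[OF mult_right_mono[OF norm2_dZ[OF elim]]]) simp_all
        show "?n * (norm2 (dZ e h - white e h) * norm2 (white f h)) \<le> ?n * (norm2 (dZ e h - white e h) * sqrt h)"
          by (rule mult_left_mono[OF mult_left_mono[OF norm2_white[OF elim]]]) simp_all
      qed
      also have "\<dots> = ?n * r h * h"
      proof -
        have "norm2 u * sqrt h = norm2 u / sqrt h * h" for u
          using elim by (simp add: field_simps)
        then show ?thesis
          by (simp add: r_def algebra_simps)
      qed
      finally have "cmod (\<tau> (a * dZ e h * b * dZ f h) - covariation e f a b * h) / h \<le> ?n * r h"
        using elim by (simp add: divide_le_eq)
      moreover have "\<tau> (a * dZ e h * b * dZ f h) / h - covariation e f a b =
          (\<tau> (a * dZ e h * b * dZ f h) - covariation e f a b * h) / h"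
        using elim by (simp add: field_simps)
      ultimately show ?case
        using elim by (simp add: norm_divide)
    qed
  qed
  then show ?thesis
    by (simp add: LIM_zero_iff)
qed

section \<open>Second-order limits for coefficients that contain \<open>P\<close>\<close>

lemma tau_word': "b \<in> F t \<inter> C \<Longrightarrow> v \<in> V \<Longrightarrow> c \<in> F t \<inter> C \<Longrightarrow> \<tau> (b * v * c) = 0"
  using tau_word[of b v c 1] subalgebra_one[OF C] by simp

lemma tau_dZ_tendsto: "((\<lambda>h. \<tau> (a * dZ e h * b)) \<longlongrightarrow> 0) (at_right 0)"
  by (rule tendsto_eq_rhs, rule bounded_linear.tendsto[OF bounded_linear_tau])
    (rule tendsto_intros dZ_tendsto | simp)+

text \<open>After a rotation \<open>tau_two_words\<close> applies. In each term one scalar trace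
  divided by h converges by the first-order limit, and a further factor still containing an
  increment tends to 0.\<close>

lemma second_order_words:
  assumes "b0 \<in> F t \<inter> C" "v \<in> V" "c0 \<in> F t \<inter> C" "b1 \<in> F t \<inter> C" "w \<in> V" "c1 \<in> F t \<inter> C"
  shows "((\<lambda>h. \<tau> (b0 * v * c0 * dZ e h * (b1 * w * c1) * dZ f h) / h) \<longlongrightarrow> 0) (at_right 0)"
proof (rule Lim_transform_eventually)
  let ?x = "\<lambda>h. \<tau> (c0 * dZ e h * b1)" and ?y = "\<lambda>h. \<tau> (c1 * dZ f h * b0)"
  have B': "b1 * c0 \<in> closure T" "b0 * c1 \<in> closure T"
    using assms by (auto intro!: closure_T_I T_base subalgebra_mult[OF C] subalgebra_mult[OF F[OF t]])
  have "?x = (\<lambda>h. \<tau> (b1 * c0 * dZ e h))" "?y = (\<lambda>h. \<tau> (b0 * c1 * dZ f h))"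
    using tau_commute[of "c0 * dZ e h" b1 for h] tau_commute[of "c1 * dZ f h" b0 for h] by (simp_all add: mult.assoc)
  then have xy: "\<tau> (b1 * c0 * dZ e h) = ?x h" "\<tau> (b0 * c1 * dZ f h) = ?y h" for h
    by metis+
  have x: "((\<lambda>h. ?x h / h) \<longlongrightarrow> - \<tau> (b1 * c0 * Z e t) / 2) (at_right 0)"
    and y: "((\<lambda>h. ?y h / h) \<longlongrightarrow> - \<tau> (b0 * c1 * Z f t) / 2) (at_right 0)"
    using first_order[OF B'(1), of e] first_order[OF B'(2), of f] by (simp_all only: xy)
  show "((\<lambda>h. ?x h / h * \<tau> ((v * w * c1) * dZ f h * b0) + ?y h / h * \<tau> ((v * c0) * dZ e h * (b1 * w))
      - ?x h / h * ?y h * \<tau> (v * w)) \<longlongrightarrow> 0) (at_right 0)"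
    by (rule tendsto_eq_rhs, (rule tendsto_intros x y tau_dZ_tendsto)+) simp
  have "\<forall>\<^sub>F h in at_right (0::real). h > 0"
    by (rule eventually_at_right_less)
  then show "\<forall>\<^sub>F h in at_right 0. ?x h / h * \<tau> ((v * w * c1) * dZ f h * b0) + ?y h / h * \<tau> ((v * c0) * dZ e h * (b1 * w))
      - ?x h / h * ?y h * \<tau> (v * w) = \<tau> (b0 * v * c0 * dZ e h * (b1 * w * c1) * dZ f h) / h"
  proof eventually_elim
    case (elim h)
    have "\<tau> (b0 * v * c0 * dZ e h * (b1 * w * c1) * dZ f h) =
        \<tau> (v * (c0 * dZ e h * b1) * w * (c1 * dZ f h * b0))"
      using tau_commute[of b0 "v * c0 * dZ e h * (b1 * w * c1) * dZ f h"] by (simp add: mult.assoc)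
    also have "\<dots> = ?x h * \<tau> (v * w * (c1 * dZ f h * b0)) + ?y h * \<tau> (v * (c0 * dZ e h * b1) * w)
        - ?x h * ?y h * \<tau> (v * w)"
      using assms elim by (intro tau_two_words subalgebra_mult C dZ_C) auto
    finally show ?case
      by (simp add: mult.assoc add_divide_distrib diff_divide_distrib)
  qed
qed

lemma covariation_word_right:
  "b \<in> F t \<inter> C \<Longrightarrow> v \<in> V \<Longrightarrow> c \<in> F t \<inter> C \<Longrightarrow> covariation e f a (b * v * c) = 0"
  using tau_word[of b v c "Z f t"] tau_word'[of b v c] Z_B by (simp add: covariation_def)

lemma covariation_commute: "covariation e f a b = covariation f e b a"
  by (simp add: covariation_def)

text \<open>The trace is zero for every h > 0: by cyclicity both increments and \<open>a\<close>
  form one element of \<open>C\<close>, tested against a word containing \<open>p\<close>.\<close>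

lemma second_order_word:
  assumes "a \<in> F t \<inter> C" "b \<in> F t \<inter> C" "v \<in> V" "c \<in> F t \<inter> C"
  shows "((\<lambda>h. \<tau> (a * dZ e h * (b * v * c) * dZ f h) / h) \<longlongrightarrow> 0) (at_right 0)"
proof (rule Lim_transform_eventually[OF tendsto_const])
  have "\<forall>\<^sub>F h in at_right (0::real). h > 0"
    by (rule eventually_at_right_less)
  then show "\<forall>\<^sub>F h in at_right 0. 0 = \<tau> (a * dZ e h * (b * v * c) * dZ f h) / h"
  proof eventually_elim
    case (elim h)
    have "\<tau> (a * dZ e h * (b * v * c) * dZ f h) = \<tau> (b * v * c * (dZ f h * a * dZ e h))"
      using tau_commute[of "a * dZ e h" "b * v * c * dZ f h"] by (simp add: mult.assoc)
    also have "\<dots> = 0"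
      using assms elim by (intro tau_word subalgebra_mult C dZ_C) auto
    finally show ?case by simp
  qed
qed

lemma second_order_commute:
  "\<tau> (a * dZ e h * b * dZ f h) = \<tau> (b * dZ f h * a * dZ e h)"
  using tau_commute[of "a * dZ e h" "b * dZ f h"] by (simp add: mult.assoc)

lemma covariation_add_right: "covariation e f a (b + c) = covariation e f a b + covariation e f a c"
  and covariation_add_left: "covariation e f (a + b) c = covariation e f a c + covariation e f b c"
  by (simp_all add: covariation_def algebra_simps tau_add)

lemma second_order_T:
  assumes "a \<in> T" "b \<in> T"
  shows "((\<lambda>h. \<tau> (a * dZ e h * b * dZ f h) / h) \<longlongrightarrow> covariation e f a b) (at_right 0)"
  using assms
proof (induction a arbitrary: b rule: T.induct)
  case (T_base a)
  from T_base(2) show ?case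
  proof (induction rule: T.induct)
    case (T_base b)
    with \<open>a \<in> F t \<inter> C\<close> show ?case by (intro second_order_past) auto
  next
    case (T_word b v c)
    with \<open>a \<in> F t \<inter> C\<close> show ?case
      using second_order_word[of a b v c e f] by (simp add: covariation_word_right)
  next
    case (T_add x y)
    then show ?case
      using tendsto_add by (force simp: algebra_simps tau_add add_divide_distrib covariation_add_right)
  qed
next
  case (T_word b0 v c0)
  from T_word(4) show ?case
  proof (induction rule: T.induct)
    case (T_base b)
    with T_word show ?case
      using second_order_word[of b b0 v c0 f e] unfolding second_order_commute[of b]
      by (simp add: covariation_word_right covariation_commute[of _ _ _ b])
  next
    case (T_word b1 w c1)
    with \<open>b0 \<in> F t \<inter> C\<close> \<open>v \<in> V\<close> \<open>c0 \<in> F t \<inter> C\<close> show ?case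
      using second_order_words[of b0 v c0 b1 w c1 e f] by (simp add: covariation_word_right)
  next
    case (T_add x y)
    then show ?case
      using tendsto_add by (force simp: algebra_simps tau_add add_divide_distrib covariation_add_right)
  qed
next
  case (T_add x y)
  from tendsto_add[OF T_add(3)[OF T_add(5)] T_add(4)[OF T_add(5)]] show ?case
    by (simp add: distrib_right tau_add add_divide_distrib covariation_add_left)
qed

lemma second_order_bound:
  assumes "h > 0"
  shows "cmod (\<tau> (a * dZ e h * b * dZ f h) / h) \<le> norm a * norm b"
proof -
  have "cmod (\<tau> (a * dZ e h * b * dZ f h)) \<le> norm a * norm b * (norm2 (dZ e h) * norm2 (dZ f h))"
    by (rule tau_two_noise_bound)
  also have "\<dots> \<le> norm a * norm b * (sqrt h * sqrt h)"
    using assms by (intro mult_left_mono mult_mono norm2_dZ) auto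
  finally show ?thesis
    using assms by (simp add: norm_divide divide_le_eq)
qed

lemma covariation_bound: "cmod (covariation e f a b) \<le> norm a * norm b"
proof -
  have "cmod (\<tau> (c * Z e t)) \<le> norm c" for c e
    using tau_bound[of "c * Z e t"] norm_mult_ineq[of c "Z e t"] norm_Z[OF t, of e] by simp
  then show ?thesis
    by (auto simp: covariation_def norm_mult intro!: mult_mono tau_bound)
qed

text \<open>The closure is reached in one argument at a time: first \<open>a\<close> with
  \<open>b\<close> still in \<open>T\<close>, then \<open>b\<close> with \<open>a\<close> fixed in
  the closure.\<close>

lemma second_order:
  assumes a: "a \<in> closure T" and b: "b \<in> closure T"
  shows "((\<lambda>h. \<tau> (a * dZ e h * b * dZ f h) / h) \<longlongrightarrow> covariation e f a b) (at_right 0)"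
proof -
  have diff: "\<tau> ((x - y) * dZ e h * b * dZ f h) / h = \<tau> (x * dZ e h * b * dZ f h) / h - \<tau> (y * dZ e h * b * dZ f h) / h"
    "\<tau> (b * dZ e h * (x - y) * dZ f h) / h = \<tau> (b * dZ e h * x * dZ f h) / h - \<tau> (b * dZ e h * y * dZ f h) / h"
    for h :: real and x y b
    by (simp_all add: algebra_simps tau_diff diff_divide_distrib)
  have cdiff: "covariation e f (x - y) b = covariation e f x b - covariation e f y b"
    "covariation e f b (x - y) = covariation e f b x - covariation e f b y" for x y b
    by (simp_all add: covariation_def algebra_simps tau_diff)
  have 1: "((\<lambda>h. \<tau> (a * dZ e h * b * dZ f h) / h) \<longlongrightarrow> covariation e f a b) (at_right 0)" if "b \<in> T" for b
    by (rule tendsto_at_right_closure[where f = "\<lambda>h a. \<tau> (a * dZ e h * b * dZ f h) / h"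
          and L = "\<lambda>a. covariation e f a b" and K = "norm b" and T = T])
      (use second_order_T that a second_order_bound covariation_bound diff cdiff in \<open>simp_all add: mult.commute[of "norm b"]\<close>)
  show ?thesis
    by (rule tendsto_at_right_closure[where f = "\<lambda>h b. \<tau> (a * dZ e h * b * dZ f h) / h"
          and L = "\<lambda>b. covariation e f a b" and K = "norm a" and T = T])
      (use 1 b second_order_bound covariation_bound diff cdiff in simp_all)
qed

end

section \<open>Functions with a continuous right derivative\<close>

text \<open>A mean value inequality for right derivatives, by looking at the infimum \<sigma> of the
  points where the inequality fails.\<close>

lemma norm_increment_le_of_right_derivative:
  fixes f :: "real \<Rightarrow> 'b::real_normed_vector"
  assumes cont: "continuous_on {a..b} f" and ab: "a \<le> b"
    and deriv: "\<And>s. a \<le> s \<Longrightarrow> s < b \<Longrightarrow>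
      ((\<lambda>h. (1 / h) *\<^sub>R (f (s + h) - f s)) \<longlongrightarrow> g s) (at_right 0)"
    and bound: "\<And>s. a \<le> s \<Longrightarrow> s < b \<Longrightarrow> norm (g s) < c"
  shows "norm (f b - f a) \<le> c * (b - a)"
proof (rule ccontr)
  assume contra: "\<not> ?thesis"
  define N where "N = {r \<in> {a..b}. norm (f r - f a) > c * (r - a)}"
  have bN: "b \<in> N"
    using contra ab by (simp add: N_def)
  define \<sigma> where "\<sigma> = Inf N"
  have bdd: "bdd_below N"
    unfolding N_def by (intro bdd_belowI[of _ a]) auto
  have \<sigma>: "a \<le> \<sigma>" "\<sigma> \<le> b"
    unfolding \<sigma>_def using bN bdd by (auto intro!: cInf_lower cInf_greatest simp: N_def)
  have before: "norm (f r - f a) \<le> c * (r - a)" if "a \<le> r" "r < \<sigma>" for r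
  proof (rule ccontr)
    assume "\<not> ?thesis"
    then have "r \<in> N"
      using that \<sigma> by (simp add: N_def)
    then show False
      using cInf_lower[OF _ bdd, of r] that by (simp add: \<sigma>_def)
  qed
  \<comment> \<open>Continuity carries the inequality from the left up to \<sigma>; the strict bound
    on the right derivative at \<sigma> then carries it beyond, contradicting the choice of
    \<sigma>.\<close>
  have at: "norm (f \<sigma> - f a) \<le> c * (\<sigma> - a)"
  proof (cases "\<sigma> = a")
    case False
    let ?D = "{a..b} \<inter> (\<lambda>r. norm (f r - f a) - c * (r - a)) -` {..0}"
    have "closed ?D"
      by (intro continuous_closed_preimage continuous_intros cont)
    then have "closure {a..<\<sigma>} \<subseteq> ?D"
      using before \<sigma> by (intro closure_minimal) auto
    then show ?thesis
      using False \<sigma> by auto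
  qed simp
  then have "\<sigma> \<noteq> b"
    using bN by (auto simp: N_def)
  then have \<sigma>b: "\<sigma> < b"
    using \<sigma> by simp
  have "\<forall>\<^sub>F h in at_right 0. norm ((1 / h) *\<^sub>R (f (\<sigma> + h) - f \<sigma>)) < c"
    by (rule order_tendstoD(2)[OF tendsto_norm[OF deriv] bound]) (use \<sigma> \<sigma>b in auto)
  then obtain d where d: "d > 0" "\<And>h. 0 < h \<Longrightarrow> h < d \<Longrightarrow> norm ((1 / h) *\<^sub>R (f (\<sigma> + h) - f \<sigma>)) < c"
    unfolding eventually_at_right_field by auto
  have after: "r \<notin> N" if "r < \<sigma> + d" for r
  proof
    assume r: "r \<in> N"
    then have "\<sigma> \<le> r"
      unfolding \<sigma>_def by (rule cInf_lower[OF _ bdd])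
    moreover have "\<sigma> \<noteq> r"
      using at r by (auto simp: N_def)
    ultimately have h: "0 < r - \<sigma>" "r - \<sigma> < d"
      using that by auto
    have "norm (f r - f \<sigma>) \<le> c * (r - \<sigma>)"
    proof -
      have "norm (f r - f \<sigma>) / (r - \<sigma>) < c"
        using d(2)[OF h] h by simp
      then show ?thesis
        using h by (simp add: pos_divide_less_eq less_imp_le)
    qed
    then have "norm (f r - f a) \<le> c * (r - \<sigma>) + c * (\<sigma> - a)"
      using at norm_triangle_ineq[of "f r - f \<sigma>" "f \<sigma> - f a"] by simp
    then show False
      using r by (simp add: N_def algebra_simps)
  qed
  have "\<sigma> + d \<le> \<sigma>"
    unfolding \<sigma>_def using bN after by (intro cInf_greatest) (auto simp: \<sigma>_def not_less[symmetric])
  with d show False by simp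
qed

lemma has_vector_derivative_of_right_derivative:
  fixes f g :: "real \<Rightarrow> 'b::real_normed_vector"
  assumes f: "continuous_on {0..} f" and g: "continuous_on {0..} g"
    and deriv: "\<And>s. s \<ge> 0 \<Longrightarrow> ((\<lambda>h. (1 / h) *\<^sub>R (f (s + h) - f s)) \<longlongrightarrow> g s) (at_right 0)"
    and t: "t \<ge> 0"
  shows "(f has_vector_derivative g t) (at t within {0..})"
  unfolding has_vector_derivative_def has_derivative_within_alt
proof (intro conjI allI impI bounded_linear_scaleR_left)
  fix e :: real assume e: "e > 0"
  obtain d where d: "d > 0" "\<And>s. s \<in> {0..} \<Longrightarrow> dist s t < d \<Longrightarrow> dist (g s) (g t) < e"
    using g t e unfolding continuous_on_iff by (metis atLeast_iff)
  have main: "norm (f v - f u - (v - u) *\<^sub>R g t) \<le> e * (v - u)"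
    if "0 \<le> u" "u \<le> v" "t - d < u" "v < t + d" for u v
  proof -
    \<comment> \<open>Its right derivative g s - g t is small near \<open>t\<close>. The inequality
      holds on intervals ending at \<open>t\<close> as well, and this is what yields the left half
      of the derivative.\<close>
    define k where "k s = f s - s *\<^sub>R g t" for s
    have "norm (k v - k u) \<le> e * (v - u)"
    proof (rule norm_increment_le_of_right_derivative)
      show "continuous_on {u..v} k"
        unfolding k_def using that by (intro continuous_intros continuous_on_subset[OF f]) auto
      fix s assume s: "u \<le> s" "s < v"
      have "((\<lambda>h. (1 / h) *\<^sub>R (f (s + h) - f s) - g t) \<longlongrightarrow> g s - g t) (at_right 0)"
        using s that by (intro tendsto_intros deriv) auto
      then show "((\<lambda>h. (1 / h) *\<^sub>R (k (s + h) - k s)) \<longlongrightarrow> g s - g t) (at_right 0)"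
        by (rule Lim_transform_eventually)
          (auto simp: k_def algebra_simps eventually_at_right_field intro!: exI[of _ 1])
      show "norm (g s - g t) < e"
        using d(2)[of s] s that by (auto simp: dist_norm abs_less_iff)
    qed fact
    moreover have "k v - k u = f v - f u - (v - u) *\<^sub>R g t"
      by (simp add: k_def algebra_simps)
    ultimately show ?thesis by simp
  qed
  show "\<exists>d>0. \<forall>y\<in>{0..}. norm (y - t) < d \<longrightarrow> norm (f y - f t - (y - t) *\<^sub>R g t) \<le> e * norm (y - t)"
  proof (intro exI[of _ d] conjI ballI impI)
    fix y :: real assume y: "y \<in> {0..}" "norm (y - t) < d"
    show "norm (f y - f t - (y - t) *\<^sub>R g t) \<le> e * norm (y - t)"
    proof (cases "t \<le> y")
      case True
      then show ?thesis
        using main[of t y] t y d by auto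
    next
      case False
      have "f y - f t - (y - t) *\<^sub>R g t = - (f t - f y - (t - y) *\<^sub>R g t)"
        by (simp add: algebra_simps)
      then have "norm (f y - f t - (y - t) *\<^sub>R g t) = norm (f t - f y - (t - y) *\<^sub>R g t)"
        by (simp only: norm_minus_cancel)
      then show ?thesis
        using False main[of y t] y d by auto
    qed
  qed (rule d)
qed

lemma bounded_linear_scaleC_left: "bounded_linear (\<lambda>c. c *\<^sub>C (x::'a::complex_normed_vector))"
  by (rule bounded_linear_intro[where K = "norm x"])
    (simp_all add: scaleC_add_left norm_scaleC scaleC_scaleC[symmetric] scaleC_of_real scaleR_conv_of_real[where 'a = complex])

section \<open>Neumann series\<close>

definition neumann :: "'a::{real_normed_algebra_1,banach} \<Rightarrow> 'a" where
  "neumann x = (\<Sum>n. x ^ n)"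

lemma neumann_sums: "norm x < 1 \<Longrightarrow> (\<lambda>n. x ^ n) sums neumann (x::'a::{real_normed_algebra_1,banach})"
  unfolding neumann_def by (intro summable_sums complete_algebra_summable_geometric)

lemma
  fixes x :: "'a::{real_normed_algebra_1,banach}"
  assumes x: "norm x < 1"
  shows neumann_left: "x * neumann x = neumann x - 1"
    and neumann_right: "neumann x * x = neumann x - 1"
proof -
  have "(\<lambda>n. x ^ Suc n) sums (neumann x - 1)"
    using neumann_sums[OF x] by (subst sums_Suc_iff) simp
  moreover have "(\<lambda>n. x ^ Suc n) sums (x * neumann x)"
    using sums_mult[OF neumann_sums[OF x], of x] by simp
  moreover have "(\<lambda>n. x ^ Suc n) sums (neumann x * x)"
    using sums_mult2[OF neumann_sums[OF x], of x] by (simp add: power_commutes)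
  ultimately show "x * neumann x = neumann x - 1" "neumann x * x = neumann x - 1"
    using sums_unique2 by blast+
qed

lemma norm_neumann_le:
  fixes x :: "'a::{real_normed_algebra_1,banach}"
  assumes "norm x \<le> r" "r < 1"
  shows "norm (neumann x) \<le> 1 / (1 - r)"
proof -
  have r: "0 \<le> r" "norm x < 1"
    using assms norm_ge_zero[of x] by linarith+
  have "neumann x = 1 + x * neumann x"
    using neumann_left[OF r(2)] by simp
  then have "norm (neumann x) \<le> 1 + norm (x * neumann x)"
    by (metis norm_one norm_triangle_ineq)
  also have "\<dots> \<le> 1 + norm x * norm (neumann x)"
    by (intro add_left_mono norm_mult_ineq)
  also have "\<dots> \<le> 1 + r * norm (neumann x)"
    by (intro add_left_mono mult_right_mono assms) simp
  finally show ?thesis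
    using assms by (simp add: field_simps)
qed

text \<open>The resolvent identity. It drives the norm continuity of the resolvent, its derivative
  in z and its expansion in time.\<close>

lemma neumann_diff:
  fixes x y :: "'a::{real_normed_algebra_1,banach}"
  assumes "norm x < 1" "norm y < 1"
  shows "neumann y - neumann x = neumann x * (y - x) * neumann y"
proof -
  have "neumann x * (y - x) * neumann y = neumann x * (y * neumann y) - neumann x * x * neumann y"
    by (simp add: algebra_simps)
  also have "\<dots> = neumann y - neumann x"
    unfolding neumann_right[OF assms(1)] neumann_left[OF assms(2)] by (simp add: algebra_simps)
  finally show ?thesis ..
qed

lemma continuous_on_neumann:
  assumes "r < 1"
  shows "continuous_on (cball 0 r) (neumann :: 'a::{real_normed_algebra_1,banach} \<Rightarrow> 'a)"
proof (rule lipschitz_on_continuous_on)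
  show "(1 / (1 - r) * (1 / (1 - r)))-lipschitz_on (cball 0 r) (neumann :: 'a \<Rightarrow> 'a)"
  proof (rule lipschitz_onI)
    fix x y :: 'a assume "x \<in> cball 0 r" "y \<in> cball 0 r"
    then have xy: "norm x \<le> r" "norm y \<le> r" by auto
    have "norm (neumann x - neumann y) = norm (neumann y * (x - y) * neumann x)"
      using neumann_diff[of y x] xy assms by simp
    also have "\<dots> \<le> norm (neumann y) * norm (x - y) * norm (neumann x)"
      by (intro order_trans[OF norm_mult_ineq] mult_right_mono norm_mult_ineq) simp
    also have "\<dots> \<le> (1 / (1 - r)) * norm (x - y) * (1 / (1 - r))"
      using assms by (intro mult_mono norm_neumann_le xy) auto
    finally show "dist (neumann x) (neumann y) \<le> 1 / (1 - r) * (1 / (1 - r)) * dist x y"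
      by (simp add: dist_norm)
  qed (use assms in simp)
qed

section \<open>The resolvent of the compressed Brownian motion\<close>

context projection_ubm
begin

definition A :: "real \<Rightarrow> 'a" where
  "A s = P * Y s * P * star (Y s)"

definition G :: "complex \<Rightarrow> real \<Rightarrow> 'a" where
  "G z s = neumann (z *\<^sub>C A s)"

lemma P_idem: "P * P = P"
  using proj by (simp add: projection_def)

lemma norm_P: "norm P \<le> 1"
  by (rule norm_projection_le[OF proj])

lemma norm_A: "s \<ge> 0 \<Longrightarrow> norm (A s) \<le> 1"
proof -
  assume "s \<ge> 0"
  then have Y: "norm (Y s) = 1"
    using norm_unitary[OF unit] by simp
  have "norm (A s) \<le> norm (P * Y s * P) * norm (star (Y s))"
    unfolding A_def by (rule norm_mult_ineq)
  also have "\<dots> \<le> norm (P * Y s) * norm P"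
    using norm_mult_ineq[of "P * Y s" P] by (simp add: Y)
  also have "\<dots> \<le> (norm P * norm (Y s)) * norm P"
    by (intro mult_right_mono norm_mult_ineq) simp
  also have "\<dots> \<le> 1"
    using norm_P by (simp add: Y mult_le_one)
  finally show ?thesis .
qed

lemma norm_zA: "s \<ge> 0 \<Longrightarrow> norm (z *\<^sub>C A s) \<le> cmod z"
  using mult_left_mono[OF norm_A, of s "cmod z"] by (simp add: norm_scaleC)

lemma norm_G: "s \<ge> 0 \<Longrightarrow> cmod z < 1 \<Longrightarrow> norm (G z s) \<le> 1 / (1 - cmod z)"
  unfolding G_def by (rule norm_neumann_le[OF norm_zA])

context
  fixes z :: complex and s :: real
  assumes z: "cmod z < 1" and s: "s \<ge> 0"
begin

lemma norm_zA_less: "norm (z *\<^sub>C A s) < 1"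
  using norm_zA[OF s, of z] z by simp

lemma AG: "z *\<^sub>C (A s * G z s) = G z s - 1"
  using neumann_left[OF norm_zA_less] by (simp add: G_def mult_scaleC_left)

lemma GA: "z *\<^sub>C (G z s * A s) = G z s - 1"
  using neumann_right[OF norm_zA_less] by (simp add: G_def mult_scaleC_right)

text \<open>\<open>A s\<close> begins with \<open>P\<close>, so \<open>P\<close> fixes every term of
  the Neumann series except the constant one.\<close>

lemma PG: "P * G z s = P + G z s - 1"
proof -
  have "G z s = 1 + z *\<^sub>C (A s * G z s)"
    by (simp add: AG)
  then have "P * G z s = P * (1 + z *\<^sub>C (A s * G z s))"
    by simp
  also have "\<dots> = P + z *\<^sub>C ((P * P) * Y s * P * star (Y s) * G z s)"
    by (simp add: distrib_left mult_scaleC_right A_def mult.assoc)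
  also have "\<dots> = P + z *\<^sub>C (A s * G z s)"
    by (simp add: P_idem A_def)
  finally show ?thesis
    by (simp add: AG)
qed

lemma PGP: "P * G z s * P = G z s * P"
  by (simp add: PG algebra_simps P_idem)

lemma moments_sums:
  "(\<lambda>n. r_moment \<tau> P Y n s * z ^ n) sums \<tau> (G z s)"
  "(\<lambda>n. s_moment \<tau> P Y n s * z ^ n) sums \<tau> (G z s * P * Y s)"
proof -
  have G: "(\<lambda>n. (z *\<^sub>C A s) ^ n) sums G z s"
    unfolding G_def by (rule neumann_sums[OF norm_zA_less])
  show "(\<lambda>n. r_moment \<tau> P Y n s * z ^ n) sums \<tau> (G z s)"
    using bounded_linear.sums[OF bounded_linear_tau G]
    by (simp add: r_moment_def A_def scaleC_power tau_scaleC mult.commute)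
  have "bounded_linear (\<lambda>x. \<tau> (x * P * Y s))"
    by (intro bounded_linear_compose[OF bounded_linear_tau] bounded_linear_compose[OF bounded_linear_mult_left]
        bounded_linear_mult_left)
  from bounded_linear.sums[OF this G]
  show "(\<lambda>n. s_moment \<tau> P Y n s * z ^ n) sums \<tau> (G z s * P * Y s)"
    by (simp add: s_moment_def A_def scaleC_power tau_scaleC mult.commute mult_scaleC_left)
qed

lemma S_series_eq: "S_series \<tau> P Y s z = \<tau> (G z s * P * Y s) - s_moment \<tau> P Y 0 s"
  unfolding S_series_def
  by (intro sums_unique[symmetric] iffD2[OF sums_Suc_iff[of "\<lambda>n. s_moment \<tau> P Y n s * z ^ n"]])
    (use moments_sums(2) in simp)

lemma M_series_eq: "M_series \<tau> P Y s z = \<tau> (G z s) - 1"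
  unfolding M_series_def
  by (intro sums_unique[symmetric] iffD2[OF sums_Suc_iff[of "\<lambda>n. r_moment \<tau> P Y n s * z ^ n"]])
    (use moments_sums(1) in \<open>simp add: r_moment_def\<close>)

text \<open>By the resolvent identity the difference quotient equals a trace in which one resolvent
  is taken at \<open>w\<close>; continuity in \<open>w\<close> finishes. The radius \<open>r\<close>
  lies midway between cmod z and 1.\<close>

lemma resolvent_has_field_derivative:
  "((\<lambda>w. \<tau> (G w s * P * Y s)) has_field_derivative \<tau> (G z s * A s * G z s * P * Y s)) (at z)"
  unfolding has_field_derivative_iff
proof (rule Lim_transform_eventually)
  define r where "r = (1 + cmod z) / 2"
  have r: "cmod z < r" "r < 1"
    using z by (simp_all add: r_def)
  have ev: "\<forall>\<^sub>F w in at z. w \<in> ball 0 r"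
    by (rule eventually_at_in_open') (use r in auto)
  have "continuous_on (ball 0 r) (\<lambda>w. neumann (w *\<^sub>C A s))"
  proof (rule continuous_on_compose2[OF continuous_on_neumann[OF r(2)]])
    show "continuous_on (ball 0 r) (\<lambda>w. w *\<^sub>C A s)"
      by (intro linear_continuous_on bounded_linear_scaleC_left)
    show "(\<lambda>w. w *\<^sub>C A s) ` ball 0 r \<subseteq> cball 0 r"
      using order_trans[OF norm_zA[OF s]] by force
  qed
  then have "isCont (\<lambda>w. G w s) z"
    unfolding G_def using r by (subst (asm) continuous_on_eq_continuous_at) auto
  then have "((\<lambda>w. G w s) \<longlongrightarrow> G z s) (at z)"
    by (simp add: isCont_def)
  then show "((\<lambda>w. \<tau> (G z s * A s * G w s * P * Y s)) \<longlongrightarrow> \<tau> (G z s * A s * G z s * P * Y s)) (at z)"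
    by (intro bounded_linear.tendsto[OF bounded_linear_tau] tendsto_intros)
  have "\<forall>\<^sub>F w in at z. w \<noteq> z"
    by (simp add: eventually_at_filter)
  with ev show "\<forall>\<^sub>F w in at z. \<tau> (G z s * A s * G w s * P * Y s) =
      (\<tau> (G w s * P * Y s) - \<tau> (G z s * P * Y s)) / (w - z)"
  proof eventually_elim
    case (elim w)
    have "norm (w *\<^sub>C A s) < 1"
      using norm_zA[OF s, of w] elim(1) r by simp
    then have "G w s - G z s = G z s * (w *\<^sub>C A s - z *\<^sub>C A s) * G w s"
      unfolding G_def by (intro neumann_diff norm_zA_less)
    also have "w *\<^sub>C A s - z *\<^sub>C A s = (w - z) *\<^sub>C A s"
      using scaleC_add_left[of w "- z" "A s"] by (simp add: scaleC_minus_left)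
    finally have "G w s * P * Y s - G z s * P * Y s = (w - z) *\<^sub>C (G z s * A s * G w s * P * Y s)"
      by (simp add: left_diff_distrib[symmetric] mult_scaleC_left mult_scaleC_right)
    then have "\<tau> (G w s * P * Y s) - \<tau> (G z s * P * Y s) = (w - z) * \<tau> (G z s * A s * G w s * P * Y s)"
      by (metis tau_diff tau_scaleC)
    then show ?case
      using elim(2) by simp
  qed
qed

text \<open>The dictionary that rewrites the traces of the time expansion in terms of \<tau> P, M,
  \<tau>(G P Y) and the z-derivative of S.\<close>

lemma tau_trace_identities:
  shows "\<tau> (G z s * P) = \<tau> P + (\<tau> (G z s) - 1)"
    and "\<tau> (G z s * G z s * P * Y s) = \<tau> (G z s * P * Y s) + z * \<tau> (G z s * A s * G z s * P * Y s)"
    and "z * \<tau> (G z s * A s) = \<tau> (G z s) - 1"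
proof -
  show "\<tau> (G z s * P) = \<tau> P + (\<tau> (G z s) - 1)"
    by (simp add: tau_commute[of _ P] PG tau_add tau_diff)
  have "z *\<^sub>C (G z s * A s * G z s * P * Y s) = z *\<^sub>C (G z s * A s) * G z s * P * Y s"
    by (simp add: mult_scaleC_left)
  also have "\<dots> = G z s * G z s * P * Y s - G z s * P * Y s"
    by (simp add: GA left_diff_distrib)
  finally show "\<tau> (G z s * G z s * P * Y s) = \<tau> (G z s * P * Y s) + z * \<tau> (G z s * A s * G z s * P * Y s)"
    by (simp add: tau_scaleC[symmetric] tau_diff)
  show "z * \<tau> (G z s * A s) = \<tau> (G z s) - 1"
    using arg_cong[OF GA, of \<tau>] by (simp add: tau_scaleC tau_diff)
qed

end

lemma S_series_has_field_derivative:
  assumes z: "cmod z < 1" and s: "s \<ge> 0"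
  shows "(S_series \<tau> P Y s has_field_derivative \<tau> (G z s * A s * G z s * P * Y s)) (at z)"
proof -
  have "((\<lambda>w. \<tau> (G w s * P * Y s) - s_moment \<tau> P Y 0 s) has_field_derivative
      \<tau> (G z s * A s * G z s * P * Y s)) (at z)"
    using DERIV_diff[OF resolvent_has_field_derivative[OF z s] DERIV_const] by simp
  then show ?thesis
    by (rule has_field_derivative_transform_within_open[of _ _ _ "ball 0 1"])
      (use z S_series_eq[OF _ s] in simp_all)
qed

lemma continuous_on_A: "continuous_on {0..} A"
  unfolding A_def by (intro continuous_intros continuous bounded_linear.continuous_on[OF bounded_linear_star])

lemma continuous_on_G: "cmod z < 1 \<Longrightarrow> continuous_on {0..} (G z)"
  unfolding G_def
  by (rule continuous_on_compose2[OF continuous_on_neumann, of "cmod z"])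
    (auto intro!: norm_zA bounded_linear.continuous_on[OF bounded_linear_scaleC] continuous_on_A)

end

section \<open>The second-order expansion of the resolvent\<close>

context projection_ubm_at
begin

text \<open>For \<open>U\<close> with at least one increment and \<open>W\<close> with at least two:
  two square roots give h, and the remaining increment, measured in operator norm, tends to
  0.\<close>

lemma third_order:
  assumes "\<And>h. h > 0 \<Longrightarrow> norm2 (U h) \<le> c * sqrt h"
    and "\<And>h. h > 0 \<Longrightarrow> norm2 (W h) \<le> c' * norm (dZ True h) * sqrt h"
  shows "((\<lambda>h. \<tau> (a * U h * b * W h) / h) \<longlongrightarrow> 0) (at_right 0)"
proof (rule Lim_null_comparison)
  show "((\<lambda>h. norm a * norm b * (c * (c' * norm (dZ True h)))) \<longlongrightarrow> 0) (at_right 0)"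
    by (rule tendsto_eq_rhs, (rule tendsto_intros dZ_tendsto)+) simp
  have "\<forall>\<^sub>F h in at_right (0::real). h > 0"
    by (rule eventually_at_right_less)
  then show "\<forall>\<^sub>F h in at_right 0. cmod (\<tau> (a * U h * b * W h) / h) \<le>
      norm a * norm b * (c * (c' * norm (dZ True h)))"
  proof eventually_elim
    case (elim h)
    have "cmod (\<tau> (a * U h * b * W h)) \<le> norm a * norm b * (norm2 (U h) * norm2 (W h))"
      by (rule tau_two_noise_bound)
    also have "\<dots> \<le> norm a * norm b * ((c * sqrt h) * (c' * norm (dZ True h) * sqrt h))"
      by (rule mult_left_mono[OF mult_mono'[OF assms(1)[OF elim] assms(2)[OF elim]]]) simp_all
    also have "\<dots> = norm a * norm b * (c * (c' * norm (dZ True h))) * (sqrt h * sqrt h)"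
      by (simp only: mult_ac)
    also have "\<dots> = norm a * norm b * (c * (c' * norm (dZ True h))) * h"
      using elim by simp
    finally show ?case
      using elim by (simp add: norm_divide pos_divide_le_eq)
  qed
qed

definition B :: "real \<Rightarrow> 'a" where
  "B h = P * dZ True h * P * star (Y t) + P * Y t * P * dZ False h"

definition E :: "real \<Rightarrow> 'a" where
  "E h = P * dZ True h * P * dZ False h"

lemma A_increment: "A (t + h) - A t = B h + E h"
proof -
  have "Y (t + h) = Y t + dZ True h" "star (Y (t + h)) = star (Y t) + dZ False h"
    by (simp_all add: dZ_def Z_def)
  then show ?thesis
    by (simp add: A_def B_def E_def algebra_simps)
qed

lemma norm_Y: "norm (Y t) = 1" "norm (star (Y t)) = 1"
  using norm_Z[OF t, of True] by (simp_all add: Z_def)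

lemma norm_dZ: "norm (dZ False h) = norm (dZ True h)" "norm2 (dZ False h) = norm2 (dZ True h)"
  by (simp_all add: dZ_star[of False])

lemma norm2_left_le: "norm a \<le> 1 \<Longrightarrow> norm2 (a * x) \<le> norm2 x"
  using norm2_mult_left[of a x] mult_right_mono[of "norm a" 1 "norm2 x"] by simp

lemma norm2_right_le: "norm a \<le> 1 \<Longrightarrow> norm2 (x * a) \<le> norm2 x"
  using norm2_mult_right[of x a] mult_right_mono[of "norm a" 1 "norm2 x"] by simp

lemma norm_left_le: "norm a \<le> 1 \<Longrightarrow> norm (a * x) \<le> norm x" for a x :: 'a
  using norm_mult_ineq[of a x] mult_right_mono[of "norm a" 1 "norm x"] by simp

lemma norm_right_le: "norm a \<le> 1 \<Longrightarrow> norm (x * a) \<le> norm x" for a x :: 'a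
  using norm_mult_ineq[of x a] mult_left_mono[of "norm a" 1 "norm x"] by simp

lemma norm_dZ_le: "h > 0 \<Longrightarrow> norm (dZ True h) \<le> 2"
  using norm_triangle_ineq4[of "Z True (t + h)" "Z True t"] norm_Z[of t True] norm_Z[of "t + h" True] t
  by (simp add: dZ_def)

lemma norm2_B: "h > 0 \<Longrightarrow> norm2 (B h) \<le> 2 * sqrt h"
proof -
  assume h: "h > 0"
  have "norm2 (P * dZ True h * P * star (Y t)) \<le> norm2 (dZ True h)"
    using norm_P norm_Y
    by (intro order_trans[OF norm2_right_le order_trans[OF norm2_right_le norm2_left_le]]) auto
  moreover have "norm2 (P * Y t * P * dZ False h) \<le> norm2 (dZ False h)"
    using norm_P norm_Y by (intro norm2_left_le order_trans[OF norm_right_le]) auto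
  ultimately show ?thesis
    using norm2_add_le[of "P * dZ True h * P * star (Y t)" "P * Y t * P * dZ False h"]
      norm2_dZ[OF h, of True] norm2_dZ[OF h, of False] by (simp add: B_def)
qed

lemma norm2_E: "h > 0 \<Longrightarrow> norm2 (E h) \<le> 1 * norm (dZ True h) * sqrt h"
proof -
  assume h: "h > 0"
  have "norm2 (E h) \<le> norm (P * dZ True h * P) * norm2 (dZ False h)"
    unfolding E_def by (rule norm2_mult_left)
  also have "\<dots> \<le> norm (dZ True h) * sqrt h"
    using norm_P by (intro mult_mono norm2_dZ[OF h] order_trans[OF norm_right_le norm_left_le]) auto
  finally show ?thesis by simp
qed

text \<open>The 4 is 2 + 2: the quadratic part also costs 2 sqrt h, because a difference of two
  unitaries has norm at most 2.\<close>

lemma norm2_increment_A: "h > 0 \<Longrightarrow> norm2 (B h + E h) \<le> 4 * sqrt h"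
proof -
  assume h: "h > 0"
  have "norm2 (E h) \<le> 2 * sqrt h"
    using norm2_E[OF h] mult_right_mono[OF norm_dZ_le[OF h] real_sqrt_ge_zero[of h]] h
    unfolding mult_1_left by linarith
  then show ?thesis
    using norm2_add_le[of "B h" "E h"] norm2_B[OF h] by simp
qed

lemma norm_increment_A: "h > 0 \<Longrightarrow> norm (B h + E h) \<le> 4 * norm (dZ True h)"
proof -
  assume h: "h > 0"
  have "norm (P * dZ True h * P * star (Y t)) \<le> norm (dZ True h)"
    using norm_P norm_Y by (intro order_trans[OF norm_right_le order_trans[OF norm_right_le norm_left_le]]) auto
  moreover have "norm (P * Y t * P * dZ False h) \<le> norm (dZ True h)"
    using norm_P norm_Y norm_dZ(1)[of h] order_trans[OF norm_left_le[of "P * Y t * P" "dZ False h"]]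
      order_trans[OF norm_right_le[of P "P * Y t"]] norm_left_le[of P "Y t"] by simp
  moreover have "norm (E h) \<le> 2 * norm (dZ True h)"
  proof -
    have "norm (E h) \<le> norm (P * dZ True h * P) * norm (dZ False h)"
      unfolding E_def by (rule norm_mult_ineq)
    also have "\<dots> \<le> 2 * norm (dZ True h)"
      unfolding norm_dZ using norm_P norm_dZ_le[OF h]
      by (intro mult_right_mono order_trans[OF norm_right_le order_trans[OF norm_left_le]]) auto
    finally show ?thesis .
  qed
  moreover have "norm (B h) \<le> norm (P * dZ True h * P * star (Y t)) + norm (P * Y t * P * dZ False h)"
    unfolding B_def by (rule norm_triangle_ineq)
  ultimately show ?thesis
    using norm_triangle_ineq[of "B h" "E h"] by simp
qed

context
  fixes z :: complex
  assumes z: "cmod z < 1"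
begin

abbreviation g :: 'a where "g \<equiv> G z t"
abbreviation y :: 'a where "y \<equiv> Y t"
abbreviation y' :: 'a where "y' \<equiv> star (Y t)"
abbreviation d :: "real \<Rightarrow> 'a" where "d \<equiv> dZ True"
abbreviation d' :: "real \<Rightarrow> 'a" where "d' \<equiv> dZ False"
abbreviation K :: "real \<Rightarrow> 'a" where "K h \<equiv> B h + E h"

lemma R_y: "y \<in> R" "y' \<in> R"
  using Z_B[of True] Z_B[of False] by (auto simp: Z_def intro: R_B)

text \<open>The Neumann series leaves the algebra of words but not the closed algebra
  \<open>R\<close>; this is the reason for working with closures.\<close>

lemma R_g: "g \<in> R"
  unfolding G_def neumann_def A_def
  using neumann_sums[OF norm_zA_less[OF z t]]
  by (intro R_suminf R_power R_scaleC R_mult R_P R_y) (auto simp: A_def sums_iff)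

lemmas R_intros = R_mult R_P R_y R_g

lemma closure_T_of_R: "a \<in> R \<Longrightarrow> a \<in> closure T"
  using R_subset by blast

lemmas first_order_R = first_order[OF closure_T_of_R]
lemmas second_order_R = second_order[OF closure_T_of_R closure_T_of_R]

text \<open>The future resolvent is kept on the right so that the step can be iterated. After three
  uses it survives only in a term with three increments of \<open>A\<close>.\<close>

lemma resolvent_step:
  assumes "h > 0"
  shows "\<tau> (a * G z (t + h) * x) = \<tau> (a * g * x) + z * \<tau> (a * g * K h * G z (t + h) * x)"
proof -
  have "G z (t + h) - g = g * (z *\<^sub>C A (t + h) - z *\<^sub>C A t) * G z (t + h)"
    unfolding G_def by (rule neumann_diff) (use assms t in \<open>auto intro!: norm_zA_less z\<close>)
  also have "\<dots> = z *\<^sub>C (g * K h * G z (t + h))"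
    by (simp add: scaleC_diff_right[symmetric] A_increment mult_scaleC_left mult_scaleC_right)
  finally have "G z (t + h) = g + z *\<^sub>C (g * K h * G z (t + h))"
    by (simp add: algebra_simps)
  then have "a * G z (t + h) * x = a * (g + z *\<^sub>C (g * K h * G z (t + h))) * x"
    by simp
  then show ?thesis
    by (simp add: distrib_left distrib_right mult_scaleC_left mult_scaleC_right tau_add tau_scaleC mult.assoc)
qed

text \<open>All words with exactly one or two increments, sorted by the power of z.\<close>

definition main_part :: "real \<Rightarrow> complex" where
  "main_part h = \<tau> (g * P * d h)
    + z * (\<tau> (g * P * d h * P * y' * g * P * y) + \<tau> (g * P * y * P * d' h * g * P * y)
      + \<tau> (g * P * d h * P * d' h * g * P * y))
    + z * (\<tau> (g * P * d h * P * y' * g * P * d h) + \<tau> (g * P * y * P * d' h * g * P * d h))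
    + z\<^sup>2 * (\<tau> (g * P * d h * P * y' * g * P * d h * P * y' * g * P * y)
      + \<tau> (g * P * d h * P * y' * g * P * y * P * d' h * g * P * y)
      + \<tau> (g * P * y * P * d' h * g * P * d h * P * y' * g * P * y)
      + \<tau> (g * P * y * P * d' h * g * P * y * P * d' h * g * P * y))"

text \<open>All words with at least three increments, rotated into the shape
  \<open>a * U h * b * W h\<close> of \<open>third_order\<close>, with at least two increments
  inside \<open>W\<close>.\<close>

definition remainder :: "real \<Rightarrow> complex" where
  "remainder h = z * \<tau> (g * P * d h * g * E h)
    + z\<^sup>2 * (\<tau> (g * P * y * g * K h * g * E h) + \<tau> (g * B h * (g * P * y * g) * E h))
    + z\<^sup>2 * \<tau> (g * K h * g * (K h * (g * P * d h)))
    + z ^ 3 * \<tau> (g * K h * g * (K h * (g * K h * G z (t + h) * P * Y (t + h))))"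

lemma expansion:
  assumes h: "h > 0"
  shows "\<tau> (G z (t + h) * P * Y (t + h)) - \<tau> (g * P * y) = main_part h + remainder h"
proof -
  have Yh: "Y (t + h) = y + d h"
    by (simp add: dZ_def Z_def)
  let ?x = "P * Y (t + h)" and ?gh = "G z (t + h)"
  have "\<tau> (?gh * ?x) = \<tau> (g * ?x) + z * (\<tau> (g * K h * g * ?x) + z * (\<tau> (g * K h * g * K h * g * ?x)
      + z * \<tau> (g * K h * g * K h * g * K h * ?gh * ?x)))"
    using resolvent_step[OF h, of 1 ?x] resolvent_step[OF h, of "g * K h" ?x]
      resolvent_step[OF h, of "g * K h * g * K h" ?x]
    by (simp add: mult.assoc)
  moreover have "\<tau> (g * ?x) = \<tau> (g * P * y) + \<tau> (g * P * d h)"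
    by (simp add: Yh distrib_left tau_add mult.assoc)
  moreover have "\<tau> (g * K h * g * ?x) = \<tau> (g * P * d h * P * y' * g * P * y) + \<tau> (g * P * y * P * d' h * g * P * y)
      + \<tau> (g * P * d h * P * d' h * g * P * y) + \<tau> (g * P * d h * P * y' * g * P * d h)
      + \<tau> (g * P * y * P * d' h * g * P * d h) + \<tau> (g * P * d h * g * E h)"
  proof -
    have "\<tau> (g * E h * g * P * d h) = \<tau> (g * P * d h * g * E h)"
      using tau_commute[of "g * E h" "g * P * d h"] by (simp add: mult.assoc)
    moreover have "\<tau> (g * K h * g * ?x) = \<tau> (g * B h * g * P * y) + \<tau> (g * E h * g * P * y)
        + \<tau> (g * B h * g * P * d h) + \<tau> (g * E h * g * P * d h)"
      by (simp add: Yh distrib_left distrib_right tau_add mult.assoc)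
    moreover have "\<tau> (g * B h * x) = \<tau> (g * P * d h * P * y' * x) + \<tau> (g * P * y * P * d' h * x)" for x
      by (simp add: B_def distrib_left distrib_right tau_add mult.assoc)
    note this[of "g * P * y"] this[of "g * P * d h"]
    moreover have "\<tau> (g * E h * g * P * y) = \<tau> (g * P * d h * P * d' h * g * P * y)"
      by (simp add: E_def mult.assoc)
    ultimately show ?thesis
      by (simp add: mult.assoc)
  qed
  moreover have "\<tau> (g * K h * g * K h * g * ?x) = \<tau> (g * B h * g * B h * g * P * y)
      + \<tau> (g * P * y * g * K h * g * E h) + \<tau> (g * B h * (g * P * y * g) * E h) + \<tau> (g * K h * g * (K h * (g * P * d h)))"
  proof -
    have "\<tau> (g * P * y * g * K h * g * E h) = \<tau> (g * K h * g * E h * g * P * y)"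
      using tau_commute[of "g * P * y" "g * K h * g * E h"] by (simp add: mult.assoc)
    moreover have "\<tau> (g * B h * (g * P * y * g) * E h) = \<tau> (g * E h * g * B h * g * P * y)"
      using tau_commute[of "g * B h * g * P * y" "g * E h"] by (simp add: mult.assoc)
    moreover have "\<tau> (g * K h * g * K h * g * ?x) =
        \<tau> (g * K h * g * K h * g * P * y) + \<tau> (g * K h * g * (K h * (g * P * d h)))"
    proof -
      have "\<tau> (k * ?x) = \<tau> (k * P * y) + \<tau> (k * (P * d h))" for k
        by (simp add: Yh distrib_left tau_add mult.assoc)
      from this[of "g * K h * g * K h * g"] show ?thesis
        by (simp only: mult.assoc)
    qed
    moreover have "\<tau> (g * K h * g * K h * g * P * y) = \<tau> (g * B h * g * B h * g * P * y)
        + \<tau> (g * K h * g * E h * g * P * y) + \<tau> (g * E h * g * B h * g * P * y)"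
      by (simp add: distrib_left distrib_right tau_add)
    ultimately show ?thesis by simp
  qed
  moreover have "\<tau> (g * B h * g * B h * g * P * y) = \<tau> (g * P * d h * P * y' * g * P * d h * P * y' * g * P * y)
      + \<tau> (g * P * d h * P * y' * g * P * y * P * d' h * g * P * y)
      + \<tau> (g * P * y * P * d' h * g * P * d h * P * y' * g * P * y)
      + \<tau> (g * P * y * P * d' h * g * P * y * P * d' h * g * P * y)"
    by (simp add: B_def distrib_left distrib_right tau_add mult.assoc)
  moreover have "\<tau> (g * K h * g * K h * g * K h * ?gh * ?x) = \<tau> (g * K h * g * (K h * (g * K h * ?gh * P * Y (t + h))))"
    by (simp only: mult.assoc)
  moreover have "\<tau> (?gh * P * Y (t + h)) = \<tau> (?gh * ?x)"
    by (simp only: mult.assoc)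
  ultimately show ?thesis
    by (simp add: main_part_def remainder_def power2_eq_square power3_eq_cube
        mult.assoc[where 'a = complex] distrib_left[where 'a = complex])
qed

lemma remainder_negligible: "((\<lambda>h. remainder h / h) \<longlongrightarrow> 0) (at_right 0)"
proof -
  have dd: "norm2 (d h) \<le> 1 * sqrt h" if "h > 0" for h
    using norm2_dZ[OF that] by simp
  have "((\<lambda>h. \<tau> (g * P * d h * g * E h) / h) \<longlongrightarrow> 0) (at_right 0)"
    by (rule third_order[OF dd norm2_E])
  moreover have "((\<lambda>h. \<tau> (g * P * y * g * K h * g * E h) / h) \<longlongrightarrow> 0) (at_right 0)"
    by (rule third_order[OF norm2_increment_A norm2_E])
  moreover have "((\<lambda>h. \<tau> (g * B h * (g * P * y * g) * E h) / h) \<longlongrightarrow> 0) (at_right 0)"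
    by (rule third_order[OF norm2_B norm2_E])
  moreover have "((\<lambda>h. \<tau> (g * K h * g * (K h * (g * P * d h))) / h) \<longlongrightarrow> 0) (at_right 0)"
  proof (rule third_order[OF norm2_increment_A])
    fix h :: real assume h: "h > 0"
    \<comment> \<open>Here the increment of \<open>A\<close> is measured in operator norm and the
      increment of \<open>Y\<close> in \<open>norm2\<close>.\<close>
    have "norm2 (K h * (g * P * d h)) \<le> norm (K h) * norm2 (g * P * d h)"
      by (rule norm2_mult_left)
    also have "\<dots> \<le> (4 * norm (d h)) * (norm (g * P) * sqrt h)"
      by (rule mult_mono'[OF norm_increment_A[OF h] order_trans[OF norm2_mult_left mult_left_mono[OF norm2_dZ[OF h]]]])
        simp_all
    finally show "norm2 (K h * (g * P * d h)) \<le> (4 * norm (g * P)) * norm (d h) * sqrt h"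
      by (simp add: mult_ac)
  qed
  moreover have "((\<lambda>h. \<tau> (g * K h * g * (K h * (g * K h * G z (t + h) * P * Y (t + h)))) / h) \<longlongrightarrow> 0) (at_right 0)"
  proof (rule third_order[OF norm2_increment_A])
    fix h :: real assume h: "h > 0"
    let ?c = "1 / (1 - cmod z)"
    have n1: "norm (Y (t + h)) \<le> 1"
      using norm_Z[of "t + h" True] t h by (simp add: Z_def)
    have "norm (g * K h * G z (t + h) * P * Y (t + h)) \<le> norm (g * K h * G z (t + h))"
      by (rule order_trans[OF norm_right_le[OF n1] norm_right_le[OF norm_P]])
    also have "\<dots> \<le> norm (g * K h) * norm (G z (t + h))"
      by (rule norm_mult_ineq)
    also have "\<dots> \<le> (norm g * norm (K h)) * norm (G z (t + h))"
      by (rule mult_right_mono[OF norm_mult_ineq]) simp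
    also have "\<dots> \<le> (norm g * (4 * norm (d h))) * ?c"
      using norm_G[OF _ z, of "t + h"] t h
      by (intro mult_mono'[OF mult_left_mono[OF norm_increment_A[OF h]]]) auto
    finally have n2: "norm (g * K h * G z (t + h) * P * Y (t + h)) \<le> (norm g * (4 * norm (d h))) * ?c" .
    \<comment> \<open>The middle increment of \<open>A\<close> is taken in \<open>norm2\<close>, the
      last one in operator norm together with the bounded future resolvent.\<close>
    have "norm2 (K h * (g * K h * G z (t + h) * P * Y (t + h))) \<le>
        norm (g * K h * G z (t + h) * P * Y (t + h)) * norm2 (K h)"
      by (rule norm2_mult_right)
    also have "\<dots> \<le> ((norm g * (4 * norm (d h))) * ?c) * (4 * sqrt h)"
      by (rule mult_mono'[OF n2 norm2_increment_A[OF h]]) simp_all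
    also have "\<dots> = (16 * norm g * ?c) * norm (d h) * sqrt h"
      by simp
    finally show "norm2 (K h * (g * K h * G z (t + h) * P * Y (t + h))) \<le> (16 * norm g * ?c) * norm (d h) * sqrt h" .
  qed
  ultimately have "((\<lambda>h. z * (\<tau> (g * P * d h * g * E h) / h)
    + z\<^sup>2 * (\<tau> (g * P * y * g * K h * g * E h) / h + \<tau> (g * B h * (g * P * y * g) * E h) / h)
    + z\<^sup>2 * (\<tau> (g * K h * g * (K h * (g * P * d h))) / h)
    + z ^ 3 * (\<tau> (g * K h * g * (K h * (g * K h * G z (t + h) * P * Y (t + h)))) / h)) \<longlongrightarrow>
      z * 0 + z\<^sup>2 * (0 + 0) + z\<^sup>2 * 0 + z ^ 3 * 0) (at_right 0)"
    by (intro tendsto_add tendsto_mult tendsto_const)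
  then show ?thesis
    by (simp add: remainder_def add_divide_distrib distrib_left)
qed

text \<open>Normal forms: words are rotated, repeated \<open>P\<close> merges, and a
  \<open>P\<close> to the left of \<open>g * P\<close> is absorbed by \<open>PGP\<close>.\<close>

lemma word_traces:
  shows "\<tau> (g * P * y * g * P * y * P * y') = \<tau> (g * A t * g * P * y)"
    and "\<tau> (P * y' * g * P * y * g * P * y) = \<tau> (g * A t * g * P * y)"
    and "\<tau> (P * y' * g * P * y * g * P * y * P) = \<tau> (g * A t * g * P * y)"
    and "\<tau> (g * P * y * P * y') = \<tau> (g * A t)"
    and "\<tau> (P * y' * g * P * y) = \<tau> (g * A t)"
    and "\<tau> (P * y' * g * P * y * P) = \<tau> (g * A t)"
    and "\<tau> (g * P * y * g * P) = \<tau> (g * g * P * y)"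
    and "\<tau> (g * P * y * P) = \<tau> (g * P * y)"
proof -
  have PP: "P * (P * x) = P * x" for x
    using P_idem by (simp add: mult.assoc[symmetric])
  have PgP: "P * (g * (P * x)) = g * (P * x)" for x
    using PGP[OF z t] by (simp add: mult.assoc[symmetric])
  show 1: "\<tau> (g * P * y * g * P * y * P * y') = \<tau> (g * A t * g * P * y)"
    using tau_commute[of "g * P * y" "g * A t"] by (simp add: A_def mult.assoc)
  show 2: "\<tau> (P * y' * g * P * y * g * P * y) = \<tau> (g * A t * g * P * y)"
    using tau_commute[of "P * y'" "g * P * y * g * P * y"] 1 by (simp add: mult.assoc)
  show "\<tau> (P * y' * g * P * y * g * P * y * P) = \<tau> (g * A t * g * P * y)"
    using tau_commute[of "P * y' * g * P * y * g * P * y" P] 2 by (simp add: mult.assoc PP)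
  show 3: "\<tau> (g * P * y * P * y') = \<tau> (g * A t)"
    by (simp add: A_def mult.assoc)
  show 4: "\<tau> (P * y' * g * P * y) = \<tau> (g * A t)"
    using tau_commute[of "P * y'" "g * P * y"] 3 by (simp add: mult.assoc)
  show "\<tau> (P * y' * g * P * y * P) = \<tau> (g * A t)"
    using tau_commute[of "P * y' * g * P * y" P] 4 by (simp add: mult.assoc PP)
  show "\<tau> (g * P * y * g * P) = \<tau> (g * g * P * y)"
    using tau_commute[of "g * P * y" "g * P"] by (simp add: mult.assoc PgP)
  show "\<tau> (g * P * y * P) = \<tau> (g * P * y)"
    using tau_commute[of "g * P * y" P] by (simp add: mult.assoc PgP)
qed

text \<open>Each word is rotated until it ends in an increment. The first- or second-order limit
  then splits it into traces, which \<open>word_traces\<close> normalises.\<close>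

lemma main_part_tendsto:
  defines "f \<equiv> \<tau> (g * P * y)" and "q \<equiv> \<tau> (g * A t * g * P * y)" and "u \<equiv> \<tau> (g * A t)"
    and "m \<equiv> \<tau> (g * P)" and "w \<equiv> \<tau> (g * g * P * y)"
  shows "((\<lambda>h. main_part h / h) \<longlongrightarrow>
    - f / 2 + z * (- q / 2 + - q / 2 + w * \<tau> P) + z * (- (f * u) + f * m)
    + z\<^sup>2 * (- (q * u) + w * u + q * m + - (q * u))) (at_right 0)"
proof -
  note simps = covariation_def Z_def word_traces f_def q_def u_def m_def w_def
  have l1: "((\<lambda>h. \<tau> (g * P * d h) / h) \<longlongrightarrow> - f / 2) (at_right 0)"
    using first_order_R[of "g * P" True] by (simp add: R_intros simps)
  have eq: "\<tau> (g * P * d h * P * y' * g * P * y) = \<tau> (P * y' * g * P * y * g * P * d h)" for h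
    using tau_commute[of "g * P * d h" "P * y' * g * P * y"] by (simp add: mult.assoc)
  have l2: "((\<lambda>h. \<tau> (g * P * d h * P * y' * g * P * y) / h) \<longlongrightarrow> - q / 2) (at_right 0)"
    unfolding eq using first_order_R[of "P * y' * g * P * y * g * P" True] by (simp add: R_intros simps)
  have eq: "\<tau> (g * P * y * P * d' h * g * P * y) = \<tau> (g * P * y * g * P * y * P * d' h)" for h
    using tau_commute[of "g * P * y * P * d' h" "g * P * y"] by (simp add: mult.assoc)
  have l3: "((\<lambda>h. \<tau> (g * P * y * P * d' h * g * P * y) / h) \<longlongrightarrow> - q / 2) (at_right 0)"
    unfolding eq using first_order_R[of "g * P * y * g * P * y * P" False] by (simp add: R_intros simps)
  have eq: "\<tau> (g * P * d h * P * d' h * g * P * y) = \<tau> (g * P * y * g * P * d h * P * d' h)" for h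
    using tau_commute[of "g * P * d h * P * d' h" "g * P * y"] by (simp add: mult.assoc)
  have l4: "((\<lambda>h. \<tau> (g * P * d h * P * d' h * g * P * y) / h) \<longlongrightarrow> w * \<tau> P) (at_right 0)"
    unfolding eq using second_order_R[of "g * P * y * g * P" P True False] by (simp add: R_intros simps)
  have eq: "\<tau> (g * P * d h * P * y' * g * P * d h) = \<tau> (g * P * d h * (P * y' * g * P) * d h)" for h
    using tau_commute[of "1" "1"] by (simp add: mult.assoc)
  have l5: "((\<lambda>h. \<tau> (g * P * d h * P * y' * g * P * d h) / h) \<longlongrightarrow> - (f * u)) (at_right 0)"
    unfolding eq using second_order_R[of "g * P" "P * y' * g * P" True True] by (simp add: R_intros simps)
  have eq: "\<tau> (g * P * y * P * d' h * g * P * d h) = \<tau> (g * P * y * P * d' h * (g * P) * d h)" for h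
    using tau_commute[of "1" "1"] by (simp add: mult.assoc)
  have l6: "((\<lambda>h. \<tau> (g * P * y * P * d' h * g * P * d h) / h) \<longlongrightarrow> f * m) (at_right 0)"
    unfolding eq using second_order_R[of "g * P * y * P" "g * P" False True] by (simp add: R_intros simps)
  have eq: "\<tau> (g * P * d h * P * y' * g * P * d h * P * y' * g * P * y) = \<tau> (P * y' * g * P * y * g * P * d h * (P * y' * g * P) * d h)" for h
    using tau_commute[of "g * P * d h * P * y' * g * P * d h" "P * y' * g * P * y"] by (simp add: mult.assoc)
  have l7: "((\<lambda>h. \<tau> (g * P * d h * P * y' * g * P * d h * P * y' * g * P * y) / h) \<longlongrightarrow> - (q * u)) (at_right 0)"
    unfolding eq using second_order_R[of "P * y' * g * P * y * g * P" "P * y' * g * P" True True] by (simp add: R_intros simps)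
  have eq: "\<tau> (g * P * d h * P * y' * g * P * y * P * d' h * g * P * y) = \<tau> (g * P * y * g * P * d h * (P * y' * g * P * y * P) * d' h)" for h
    using tau_commute[of "g * P * d h * P * y' * g * P * y * P * d' h" "g * P * y"] by (simp add: mult.assoc)
  have l8: "((\<lambda>h. \<tau> (g * P * d h * P * y' * g * P * y * P * d' h * g * P * y) / h) \<longlongrightarrow> w * u) (at_right 0)"
    unfolding eq using second_order_R[of "g * P * y * g * P" "P * y' * g * P * y * P" True False] by (simp add: R_intros simps)
  have eq: "\<tau> (g * P * y * P * d' h * g * P * d h * P * y' * g * P * y) = \<tau> (P * y' * g * P * y * g * P * y * P * d' h * (g * P) * d h)" for h
    using tau_commute[of "g * P * y * P * d' h * g * P * d h" "P * y' * g * P * y"] by (simp add: mult.assoc)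
  have l9: "((\<lambda>h. \<tau> (g * P * y * P * d' h * g * P * d h * P * y' * g * P * y) / h) \<longlongrightarrow> q * m) (at_right 0)"
    unfolding eq using second_order_R[of "P * y' * g * P * y * g * P * y * P" "g * P" False True] by (simp add: R_intros simps)
  have eq: "\<tau> (g * P * y * P * d' h * g * P * y * P * d' h * g * P * y) = \<tau> (g * P * y * g * P * y * P * d' h * (g * P * y * P) * d' h)" for h
    using tau_commute[of "g * P * y * P * d' h * g * P * y * P * d' h" "g * P * y"] by (simp add: mult.assoc)
  have l10: "((\<lambda>h. \<tau> (g * P * y * P * d' h * g * P * y * P * d' h * g * P * y) / h) \<longlongrightarrow> - (q * u)) (at_right 0)"
    unfolding eq using second_order_R[of "g * P * y * g * P * y * P" "g * P * y * P" False False] by (simp add: R_intros simps)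
  have "((\<lambda>h. \<tau> (g * P * d h) / h
    + z * (\<tau> (g * P * d h * P * y' * g * P * y) / h + \<tau> (g * P * y * P * d' h * g * P * y) / h
      + \<tau> (g * P * d h * P * d' h * g * P * y) / h)
    + z * (\<tau> (g * P * d h * P * y' * g * P * d h) / h + \<tau> (g * P * y * P * d' h * g * P * d h) / h)
    + z\<^sup>2 * (\<tau> (g * P * d h * P * y' * g * P * d h * P * y' * g * P * y) / h
      + \<tau> (g * P * d h * P * y' * g * P * y * P * d' h * g * P * y) / h
      + \<tau> (g * P * y * P * d' h * g * P * d h * P * y' * g * P * y) / h
      + \<tau> (g * P * y * P * d' h * g * P * y * P * d' h * g * P * y) / h)) \<longlongrightarrow>
    - f / 2 + z * (- q / 2 + - q / 2 + w * \<tau> P) + z * (- (f * u) + f * m)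
    + z\<^sup>2 * (- (q * u) + w * u + q * m + - (q * u))) (at_right 0)"
    by (intro tendsto_add tendsto_mult tendsto_const l1 l2 l3 l4 l5 l6 l7 l8 l9 l10)
  then show ?thesis
    unfolding main_part_def add_divide_distrib times_divide_eq_right[symmetric] .
qed

end

end

section \<open>The evolution equation\<close>

lemma (in projection_ubm_at) resolvent_right_derivative:
  assumes z: "cmod z < 1"
  defines "f \<equiv> \<tau> (G z t * P * Y t)" and "q \<equiv> \<tau> (G z t * A t * G z t * P * Y t)" and "M \<equiv> \<tau> (G z t) - 1"
  shows "((\<lambda>h. (\<tau> (G z (t + h) * P * Y (t + h)) - f) / h) \<longlongrightarrow>
    (2 * z * (\<tau> P + M) - M - 1 / 2) * f + (2 * z * (\<tau> P + M) - (1 + 2 * M)) * z * q) (at_right 0)"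
proof -
  define u where "u = \<tau> (G z t * A t)"
  note ids = tau_trace_identities[OF z t, folded f_def q_def M_def u_def]
  have "((\<lambda>h. main_part z h / h + remainder z h / h) \<longlongrightarrow>
      (- f / 2 + z * (- q / 2 + - q / 2 + (f + z * q) * \<tau> P) + z * (- (f * u) + f * (\<tau> P + M))
    + z\<^sup>2 * (- (q * u) + (f + z * q) * u + q * (\<tau> P + M) + - (q * u))) + 0) (at_right 0)"
    using tendsto_add[OF main_part_tendsto[OF z] remainder_negligible[OF z]]
    unfolding ids(1,2) f_def[symmetric] q_def[symmetric] u_def[symmetric] .
  \<comment> \<open>With \<open>M\<close> written as z * u every power of z matches; collecting the
    coefficients of \<open>f\<close> and of \<open>q\<close> gives the two brackets.\<close>
  also have "(- f / 2 + z * (- q / 2 + - q / 2 + (f + z * q) * \<tau> P) + z * (- (f * u) + f * (\<tau> P + M))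
    + z\<^sup>2 * (- (q * u) + (f + z * q) * u + q * (\<tau> P + M) + - (q * u))) + 0 =
      (2 * z * (\<tau> P + M) - M - 1 / 2) * f + (2 * z * (\<tau> P + M) - (1 + 2 * M)) * z * q"
    unfolding ids(3)[symmetric] by (simp add: field_simps power2_eq_square)
  finally show ?thesis
  proof (rule Lim_transform_eventually)
    have "\<forall>\<^sub>F h in at_right (0::real). h > 0"
      by (rule eventually_at_right_less)
    then show "\<forall>\<^sub>F h in at_right 0. main_part z h / h + remainder z h / h =
        (\<tau> (G z (t + h) * P * Y (t + h)) - f) / h"
      by eventually_elim (simp add: f_def expansion[OF z] add_divide_distrib)
  qed
qed

lemma (in projection_ubm) S_series_evolution:
  assumes z: "cmod z < 1" and t: "t \<ge> 0"
  defines "M \<equiv> M_series \<tau> P Y t z" and "S \<equiv> S_series \<tau> P Y t" and "s0 \<equiv> s_moment \<tau> P Y 0 t"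
  shows "((\<lambda>u. S_series \<tau> P Y u z) has_vector_derivative
        s0 * (2 * z * (\<tau> P + M) - M) + (2 * z * (\<tau> P + M) - M - 1 / 2) * S z
      + (2 * z * (\<tau> P + M) - (1 + 2 * M)) * z * deriv S z)
    (at t within {0..})"
proof -
  define f where "f s = \<tau> (G z s * P * Y s)" for s
  define q where "q s = \<tau> (G z s * A s * G z s * P * Y s)" for s
  define m where "m s = \<tau> (G z s) - 1" for s
  \<comment> \<open>S is \<open>f\<close> minus the zeroth moment, whose derivative is minus one
    half of itself; this gives the last summand. Substituting f = S + s0, it cancels the -1/2 in the
    coefficient of s0, which is why only the bracket of S keeps it.\<close>
  define D where "D s = (2 * z * (\<tau> P + m s) - m s - 1 / 2) * f s
      + (2 * z * (\<tau> P + m s) - (1 + 2 * m s)) * z * q s + \<tau> (P * Y s) / 2" for s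
  have cont: "continuous_on {0..} f" "continuous_on {0..} q" "continuous_on {0..} m"
    "continuous_on {0..} (\<lambda>s. \<tau> (P * Y s))"
    unfolding f_def q_def m_def
    by (intro continuous_intros bounded_linear.continuous_on[OF bounded_linear_tau]
        continuous_on_G[OF z] continuous_on_A continuous)+
  have "((\<lambda>s. f s - \<tau> (P * Y s)) has_vector_derivative D t) (at t within {0..})"
  proof (rule has_vector_derivative_of_right_derivative[OF _ _ _ t])
    show "continuous_on {0..} (\<lambda>s. f s - \<tau> (P * Y s))" "continuous_on {0..} D"
      unfolding D_def by (intro continuous_intros cont; simp)+
    fix s :: real assume s: "s \<ge> 0"
    interpret s: projection_ubm_at \<tau> F X Y P s
      by unfold_locales (rule s)
    have "P \<in> closure s.T"
      using s.R_P s.R_subset by blast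
    from s.first_order[OF this, of True]
    have "((\<lambda>h. (\<tau> (P * Y (s + h)) - \<tau> (P * Y s)) / h) \<longlongrightarrow> - \<tau> (P * Y s) / 2) (at_right 0)"
      by (simp add: s.dZ_def s.Z_def right_diff_distrib tau_diff)
    from tendsto_diff[OF s.resolvent_right_derivative[OF z] this]
    have "((\<lambda>h. (f (s + h) - f s) / h - (\<tau> (P * Y (s + h)) - \<tau> (P * Y s)) / h) \<longlongrightarrow> D s) (at_right 0)"
      by (simp add: f_def q_def m_def D_def)
    then show "((\<lambda>h. (1 / h) *\<^sub>R (f (s + h) - \<tau> (P * Y (s + h)) - (f s - \<tau> (P * Y s)))) \<longlongrightarrow> D s) (at_right 0)"
      by (simp add: scaleR_conv_of_real diff_divide_distrib algebra_simps)
  qed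
  then have "((\<lambda>s. S_series \<tau> P Y s z) has_vector_derivative D t) (at t within {0..})"
    by (rule has_vector_derivative_transform[rotated 2])
      (use t in \<open>auto simp: S_series_eq[OF z] f_def s_moment_def\<close>)
  moreover have "deriv S z = q t"
    unfolding S_def q_def by (rule DERIV_imp_deriv[OF S_series_has_field_derivative[OF z t]])
  moreover have "f t = S z + s0" "m t = M" "\<tau> (P * Y t) = s0"
    by (simp_all add: S_def f_def s0_def M_def m_def S_series_eq[OF z t] M_series_eq[OF z t] s_moment_def)
  ultimately show ?thesis
    by (simp add: D_def algebra_simps add_divide_distrib)
qed

theorem corollary4p3:
  fixes \<pi> :: "'a::cstar_algebra \<Rightarrow> 'h::chilbert_space \<Rightarrow> 'h"
    and \<tau> :: "'a \<Rightarrow> complex"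
    and P :: 'a and Y :: "real \<Rightarrow> 'a" and \<alpha> :: real
    and s0 :: "real \<Rightarrow> complex" and S M :: "real \<Rightarrow> complex \<Rightarrow> complex"
  assumes "von_neumann_algebra \<pi>"
    and "faithful_tracial_state \<tau>"
    and "0 < \<alpha>" and "\<alpha> \<le> 1"
    and "projection P" and "\<tau> P = complex_of_real \<alpha>"
    and "free_unitary_brownian_motion \<tau> Y"
    and "star_free \<tau> {P} (Y ` {0..})"
  defines "s0 \<equiv> s_moment \<tau> P Y 0"
    and "S \<equiv> S_series \<tau> P Y"
    and "M \<equiv> M_series \<tau> P Y"
  shows "\<forall>t\<ge>0. \<forall>z. cmod z < 1 \<longrightarrow>
    S t field_differentiable at z \<and>
    ((\<lambda>u. S u z) has_vector_derivative
        s0 t * (2 * z * (complex_of_real \<alpha> + M t z) - M t z)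
      + (2 * z * (complex_of_real \<alpha> + M t z) - M t z - 1 / 2) * S t z
      + (2 * z * (complex_of_real \<alpha> + M t z) - (1 + 2 * M t z)) * z * deriv (S t) z)
    (at t within {0..})"
proof -
  obtain F X where "free_brownian_motion \<tau> F X" "adapted F Y" "continuous_on {0..} Y"
    "\<forall>t\<ge>0. unitary (Y t)" "\<forall>t\<ge>0. \<exists>I. has_free_ito_integral Y X I 0 t \<and>
      Y t - Y 0 = \<i> *\<^sub>C I - (1/2) *\<^sub>R integral {0..t} Y"
    using assms(7) unfolding free_unitary_brownian_motion_def by blast
  then interpret projection_ubm \<tau> F X Y P
    by unfold_locales (use assms in auto)
  show ?thesis
    unfolding s0_def S_def M_def assms(6)[symmetric] field_differentiable_def
    using S_series_has_field_derivative S_series_evolution by blast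
qed

end
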